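(* Given a Laurent polynomial $F(\mathbf x)\in\mathbb Q[\mathbf x^{\pm}]$, the cluster symmetric set $\mathcal S(F)$ of $F(\mathbf x)$ can be obtained by the Routine described in the context. That is, the Routine completes in finitely many steps and yields the set $\mathcal M(F)$ of all non-trivial cluster symmetric pairs of $F$, and $$\mathcal S(F)=\{\psi_{\sigma,s,\omega_s}\mid(\psi_{\sigma,s,\omega_s},\mathbf 0)\in\mathcal M(F)\}.$$
   Context: Notation. Fix $n\ge1$ and indeterminates $\mathbf x=(x_1,\dots,x_n)$. For an $n$-tuple $\mathbf v$, $\mathbf x^{\mathbf v}=\prod x_i^{v_i}$; for $\sigma\in\mathfrak S_n$, $\sigma(\mathbf v)=(v_{\sigma(1)},\dots,v_{\sigma(n)})$. $[a]_+=\max\{a,0\}$, applied componentwise to tuples. $\mathbf e_k$ is the $k$-th standard basis vector, and $\deg^k$ is the degree in $x_k$ (with $\deg^k 0=0$). Cluster symmetric maps. A seedlet at direction $s\in[1,n]$ is a triple $\omega_s=(\mathbf b,r,Z)$ with $\mathbf b\in\mathbb Z^n$, $b_s=0$, $r$ a positive integer, $Z(u)=\sum_{i=0}^r z_iu^i\in\mathbb Z_{\ge0}[u]$ and $z_0,z_r>0$. Its exchange polynomial is $P_{\omega_s}(\mathbf x)=\mathbf x^{r[-\mathbf b]_+}Z(\mathbf x^{\mathbf b})$. For $\sigma\in\mathfrak S_n$ and $t=\sigma^{-1}(s)$, the cluster symmetric map $\psi_{\sigma,s,\omega_s}(\mathbf x)$ is the $n$-tuple whose $i$-th component is $x_{\sigma(i)}$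 for $i\ne t$ and whose $t$-th component is $P_{\omega_s}(\mathbf x)/x_s$. Type. $F$ is of type $\frac{\bm\eta}{\mathbf d}$ if $F=T(\mathbf x)/\mathbf x^{\mathbf d}$ with $T\in\mathbb Q[\mathbf x]$, $\mathbf d\in\mathbb Z^n$, $x_i\nmid T$ for all $i$, and $\eta_i=\deg^iT$. Cluster symmetric set. For $F$ of type $\frac{\bm\eta}{\mathbf d}$, $\mathcal S(F)=\{\psi_{\sigma,s,\omega_s}\mid F(\psi_{\sigma,s,\omega_s}(\mathbf x))=F(\mathbf x),\ \eta_s\ne0\}$. Cluster symmetric pairs. A pair $(\psi_{\sigma,s,\omega_s},\widetilde{\mathbf d})$ with $\widetilde{\mathbf d}\in\mathbb Z^n$ is a cluster symmetric pair of $F$ if $\widetilde F(\psi_{\sigma,s,\omega_s}(\mathbf x))=\widetilde F(\mathbf x)$, where $\widetilde F=\mathbf x^{-\widetilde{\mathbf d}}F$. For $F=T/\mathbf x^{\mathbf d}$ of type $\frac{\bm\eta}{\mathbf d}$ it is trivial if $\eta_s=\eta_{\sigma^{-1}(s)}=0$, $T(\sigma(\mathbf x))=T(\mathbf x)$, $\sigma(\mathbf d+\widetilde{\mathbf d})=\mathbf d+\widetilde{\mathbf d}$ and $d_s+\widetilde d_s=0$; otherwise it is non-trivial. $\mathcal M(F)$ is the set of non-trivial cluster symmetric pairs of $F$. Routine (input $F$). (1) Set $\mathcal M(F)\gets\emptyset$. Let $F=T/\mathbf x^{\mathbf d}$ be of type $\frac{\bm\eta}{\mathbf d}$ and let $S=\{i\in[1,n]\mid\eta_i\text{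 is even and nonzero}\}$. (2) If $S$ is empty, stop. (3) Pick $s\in S$ and compute $\Sigma_s=\{\sigma\in\mathfrak S_n\mid\sigma^{-1}(s)\in S,\ \eta_s=\eta_{\sigma^{-1}(s)}\}$. (a) If $\Sigma_s$ is empty, set $S\gets S\setminus\{s\}$ and go to (2). (b) Pick $\sigma\in\Sigma_s$. Let $t=\sigma^{-1}(s)$ and let $\widetilde{\mathbf d}=(\widetilde d_1,\dots,\widetilde d_n)$ be the $n$-tuple of free variables satisfying $\sigma(\mathbf d+\widetilde{\mathbf d})=\mathbf d+\widetilde{\mathbf d}$ and $2(d_s+\widetilde d_s)=\eta_s$. (i) Write $T=\sum_{i=0}^{\eta_s}f_{s,i}(\mathbf x)\,\mathbf x^{i\mathbf e_s}$ with polynomials $f_{s,i}$ such that $\deg^sf_{s,i}=0$. (ii) Write $T=\sum_{i=0}^{\eta_t}f_{t,i}(\mathbf x)\,\mathbf x^{i\mathbf e_t}$ with polynomials $f_{t,i}$ such that $\deg^tf_{t,i}=0$. (iii) Pick an integer $k_0\in[0,\eta_s/2)$ with $f_{t,k_0}\ne0$ and $f_{s,\eta_s-k_0}\ne0$, and let $P(\mathbf x)=\big(f_{t,k_0}(\sigma(\mathbf x))/f_{s,\eta_s-k_0}(\mathbf x)\big)^{1/(d_s+\widetilde d_s-k_0)}$. Check that $f_{t,i}(\sigma(\mathbf x))=f_{s,\eta_s-i}(\mathbf x)P(\mathbf x)^{d_s+\widetilde d_s-i}$ for every $i\in[0,\eta_s]$. If this fails, set $\Sigma_s\gets\Sigma_s\setminus\{\sigma\}$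 and return to (b) (to (a) if $\Sigma_s$ has become empty). (iv) Set $\mathcal W\gets\{(\mathbf b,r)\in\mathbb Z^n\times\mathbb Z_{>0}\mid b_s=0,\ \min\{\eta_k,\eta_{\sigma^{-1}(k)}\}\ge\tfrac12\eta_sr|b_k|\ge|\eta_k-\eta_{\sigma^{-1}(k)}|\text{ for all }k\in[1,n]\}$. (A) If $\mathcal W$ is empty, set $\Sigma_s\gets\Sigma_s\setminus\{\sigma\}$ and return to (b) (to (a) if $\Sigma_s$ has become empty). (B) Pick $(\mathbf b,r)\in\mathcal W$. If there is a polynomial $Z(u)=\sum_{i=0}^rz_iu^i$ with $z_0,z_r\ne0$ and $P(\mathbf x)=\mathbf x^{r[-\mathbf b]_+}Z(\mathbf x^{\mathbf b})$, let $\omega_s=(\mathbf b,r,Z)$ be a seedlet and set $\mathcal M(F)\gets\mathcal M(F)\cup\{(\psi_{\sigma,s,\omega_s},\widetilde{\mathbf d})\}$. In either case remove $(\mathbf b,r)$ from $\mathcal W$ and go to (A).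
   Formalization: Proved for F≠0 with the Routine mended: Σ_s uses the initial set S of step (1), not the shrinking one; after treating one (0,r), all (0,r') are removed from W, which may be infinite; Z in (B) must have nonnegative integer coefficients; P in (iii) is the positive root in Q(x). *)

theory Defs
  imports
    "HOL-Library.Poly_Mapping"
    "HOL-Computational_Algebra.Polynomial"
    "HOL-Computational_Algebra.Fraction_Field"
begin

text \<open>
  The index set \<open>[1,n]\<close> is a nonempty finite type \<open>'n\<close>. Its linear order is used only to make
  the polynomial ring an instance of \<open>idom\<close> (so that its fraction field exists) and to fix a sign
  convention for roots below.
\<close>

section \<open>Polynomials, Laurent polynomials and rational functions over the rationals\<close>

type_synonym 'n mpoly = "('n \<Rightarrow>\<^sub>0 nat) \<Rightarrow>\<^sub>0 rat"
type_synonym 'n laurent = "('n \<Rightarrow>\<^sub>0 int) \<Rightarrow>\<^sub>0 rat"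
type_synonym 'n ratfun = "'n mpoly fract"

definition pvar :: "'n \<Rightarrow> 'n mpoly" where
  "pvar i = Poly_Mapping.single (Poly_Mapping.single i 1) 1"

definition mdeg :: "'n \<Rightarrow> 'n mpoly \<Rightarrow> nat" where
  "mdeg i p = Max (insert 0 ((\<lambda>m. Poly_Mapping.lookup m i) ` Poly_Mapping.keys p))"

definition ratconst :: "rat \<Rightarrow> 'n::{finite,linorder} ratfun" where
  "ratconst c = Fract (Poly_Mapping.single 0 c) 1"

definition X :: "'n::{finite,linorder} \<Rightarrow> 'n ratfun" where
  "X i = Fract (pvar i) 1"

text \<open>Evaluation of polynomials and Laurent polynomials at a tuple \<open>v\<close> of rational functions; for
  Laurent polynomials it is only used at tuples of nonzero rational functions.\<close>

definition monom_at :: "('n::{finite,linorder} \<Rightarrow> 'n ratfun) \<Rightarrow> ('n \<Rightarrow> int) \<Rightarrow> 'n ratfun" where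
  "monom_at v e = (\<Prod>i\<in>UNIV. v i powi e i)"

definition poly_at :: "'n::{finite,linorder} mpoly \<Rightarrow> ('n \<Rightarrow> 'n ratfun) \<Rightarrow> 'n ratfun" where
  "poly_at p v = (\<Sum>m\<in>Poly_Mapping.keys p.
     ratconst (Poly_Mapping.lookup p m) * (\<Prod>i\<in>UNIV. v i ^ Poly_Mapping.lookup m i))"

definition laurent_at :: "'n::{finite,linorder} laurent \<Rightarrow> ('n \<Rightarrow> 'n ratfun) \<Rightarrow> 'n ratfun" where
  "laurent_at F v = (\<Sum>m\<in>Poly_Mapping.keys F.
     ratconst (Poly_Mapping.lookup F m) * monom_at v (Poly_Mapping.lookup m))"

definition laurent_monom :: "('n::finite \<Rightarrow> int) \<Rightarrow> 'n laurent" where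
  "laurent_monom e = Poly_Mapping.single (Abs_poly_mapping e) 1"

text \<open>\<open>F = T / x\<^sup>d\<close> with \<open>x\<^sub>i\<close> not dividing \<open>T\<close>; then \<open>F\<close> is of type \<open>\<eta> / d\<close> with
  \<open>\<eta>\<^sub>i = mdeg i T\<close>. Such \<open>(T, d)\<close> is unique if it exists, and it exists iff \<open>F \<noteq> 0\<close>.\<close>

definition type_rep :: "'n::{finite,linorder} laurent \<Rightarrow> 'n mpoly \<Rightarrow> ('n \<Rightarrow> int) \<Rightarrow> bool" where
  "type_rep F T d \<longleftrightarrow>
     laurent_at F X = poly_at T X / monom_at X d \<and> (\<forall>i. \<not> pvar i dvd T)"

section \<open>Cluster symmetric maps and pairs\<close>

text \<open>The coefficients of \<open>Z\<close> are nonnegative integers, hence \<open>nat poly\<close>.\<close>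

type_synonym 'n seedlet = "('n \<Rightarrow> int) \<times> nat \<times> nat poly"

definition is_seedlet :: "'n \<Rightarrow> 'n seedlet \<Rightarrow> bool" where
  "is_seedlet s \<omega> \<longleftrightarrow> (case \<omega> of (b, r, Z) \<Rightarrow>
     b s = 0 \<and> r > 0 \<and> degree Z \<le> r \<and> coeff Z 0 > 0 \<and> coeff Z r > 0)"

definition exchange_poly :: "'n::{finite,linorder} seedlet \<Rightarrow> 'n ratfun" where
  "exchange_poly \<omega> = (case \<omega> of (b, r, Z) \<Rightarrow>
     monom_at X (\<lambda>i. int r * max (- b i) 0) * poly (map_poly of_nat Z) (monom_at X b))"

definition cs_map :: "('n \<Rightarrow> 'n) \<Rightarrow> 'n \<Rightarrow> 'n seedlet \<Rightarrow> 'n::{finite,linorder} \<Rightarrow> 'n ratfun" where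
  "cs_map \<sigma> s \<omega> = (\<lambda>i. if i = inv \<sigma> s then exchange_poly \<omega> / X s else X (\<sigma> i))"

definition cluster_symmetric_set ::
    "'n::{finite,linorder} laurent \<Rightarrow> ('n \<Rightarrow> 'n ratfun) set" where
  "cluster_symmetric_set F = {cs_map \<sigma> s \<omega> | \<sigma> s \<omega>.
     bij \<sigma> \<and> is_seedlet s \<omega> \<and>
     laurent_at F (cs_map \<sigma> s \<omega>) = laurent_at F X \<and>
     (\<exists>T d. type_rep F T d \<and> mdeg s T \<noteq> 0)}"

definition is_cs_pair ::
    "'n::{finite,linorder} laurent \<Rightarrow> ('n \<Rightarrow> 'n) \<Rightarrow> 'n \<Rightarrow> 'n seedlet \<Rightarrow> ('n \<Rightarrow> int) \<Rightarrow> bool" where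
  "is_cs_pair F \<sigma> s \<omega> d' \<longleftrightarrow>
     (let F' = laurent_monom (\<lambda>i. - d' i) * F
      in laurent_at F' (cs_map \<sigma> s \<omega>) = laurent_at F' X)"

definition is_trivial ::
    "'n::{finite,linorder} laurent \<Rightarrow> ('n \<Rightarrow> 'n) \<Rightarrow> 'n \<Rightarrow> ('n \<Rightarrow> int) \<Rightarrow> bool" where
  "is_trivial F \<sigma> s d' \<longleftrightarrow> (\<exists>T d. type_rep F T d \<and>
     mdeg s T = 0 \<and> mdeg (inv \<sigma> s) T = 0 \<and>
     poly_at T (X \<circ> \<sigma>) = poly_at T X \<and>
     (\<forall>i. d (\<sigma> i) + d' (\<sigma> i) = d i + d' i) \<and> d s + d' s = 0)"

definition nontrivial_cs_pairs ::
    "'n::{finite,linorder} laurent \<Rightarrow> (('n \<Rightarrow> 'n ratfun) \<times> ('n \<Rightarrow> int)) set" where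
  "nontrivial_cs_pairs F = {(cs_map \<sigma> s \<omega>, d') | \<sigma> s \<omega> d'.
     bij \<sigma> \<and> is_seedlet s \<omega> \<and> is_cs_pair F \<sigma> s \<omega> d' \<and> \<not> is_trivial F \<sigma> s d'}"

section \<open>The routine as a transition system\<close>

definition even_dirs :: "'n mpoly \<Rightarrow> 'n set" where
  "even_dirs T = {i. even (mdeg i T) \<and> mdeg i T \<noteq> 0}"

text \<open>The membership condition refers to the initial set \<open>S\<close> of directions, not to what is left of it
  in the loop: with the shrinking set, a map whose \<open>\<sigma>\<^sup>-\<^sup>1(s)\<close> was handled before \<open>s\<close> would be lost.\<close>

definition Sigma_init :: "'n mpoly \<Rightarrow> 'n \<Rightarrow> ('n \<Rightarrow> 'n) set" where
  "Sigma_init T s = {\<sigma>. bij \<sigma> \<and> inv \<sigma> s \<in> even_dirs T \<and> mdeg s T = mdeg (inv \<sigma> s) T}"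

text \<open>A tuple of free variables subject to linear equations stands for all its integer values.\<close>

definition free_tuples ::
    "'n mpoly \<Rightarrow> ('n \<Rightarrow> int) \<Rightarrow> 'n \<Rightarrow> ('n \<Rightarrow> 'n) \<Rightarrow> ('n \<Rightarrow> int) set" where
  "free_tuples T d s \<sigma> = {d'. (\<forall>i. d (\<sigma> i) + d' (\<sigma> i) = d i + d' i) \<and>
     2 * (d s + d' s) = int (mdeg s T)}"

definition expansion :: "'n::{finite,linorder} \<Rightarrow> 'n mpoly \<Rightarrow> (nat \<Rightarrow> 'n mpoly) \<Rightarrow> bool" where
  "expansion s T f \<longleftrightarrow> (\<forall>i\<le>mdeg s T. mdeg s (f i) = 0) \<and> T = (\<Sum>i\<le>mdeg s T. f i * pvar s ^ i)"

text \<open>Roots are taken in the field of rational functions. When the exponent is even and a root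
  exists there, there are two, \<open>P\<close> and \<open>-P\<close>; we take the positive one for the ordering of the field
  in which a polynomial is positive iff its leading coefficient is. Exchange polynomials are
  positive, having nonnegative coefficients.\<close>

definition lead_coef :: "'n::{finite,linorder} mpoly \<Rightarrow> rat" where
  "lead_coef p = Poly_Mapping.lookup p (Max (Poly_Mapping.keys p))"

definition ratfun_pos :: "'n::{finite,linorder} ratfun \<Rightarrow> bool" where
  "ratfun_pos P \<longleftrightarrow> (\<exists>p q. p \<noteq> 0 \<and> q \<noteq> 0 \<and> P = Fract p q \<and> lead_coef p > 0 \<and> lead_coef q > 0)"

definition is_root :: "nat \<Rightarrow> 'n::{finite,linorder} ratfun \<Rightarrow> 'n ratfun \<Rightarrow> bool" where
  "is_root m R P \<longleftrightarrow> P ^ m = R \<and> (even m \<longrightarrow> ratfun_pos P)"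

text \<open>Here \<open>h\<close> is the common value \<open>\<eta>\<^sub>s / 2\<close> of \<open>d\<^sub>s + d'\<^sub>s\<close> for the free tuples \<open>d'\<close>.\<close>

definition k0_choice :: "nat \<Rightarrow> (nat \<Rightarrow> 'n mpoly) \<Rightarrow> (nat \<Rightarrow> 'n mpoly) \<Rightarrow> nat \<Rightarrow> bool" where
  "k0_choice h fs ft k0 \<longleftrightarrow> k0 < h \<and> ft k0 \<noteq> 0 \<and> fs (2 * h - k0) \<noteq> 0"

definition P_passes ::
    "nat \<Rightarrow> (nat \<Rightarrow> 'n::{finite,linorder} mpoly) \<Rightarrow> (nat \<Rightarrow> 'n mpoly) \<Rightarrow> ('n \<Rightarrow> 'n) \<Rightarrow> nat \<Rightarrow> 'n ratfun \<Rightarrow> bool"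
  where
  "P_passes h fs ft \<sigma> k0 P \<longleftrightarrow>
     is_root (h - k0) (poly_at (ft k0) (X \<circ> \<sigma>) / poly_at (fs (2 * h - k0)) X) P \<and>
     (\<forall>i\<le>2 * h. poly_at (ft i) (X \<circ> \<sigma>) = poly_at (fs (2 * h - i)) X * P powi (int h - int i))"

definition W_init :: "'n mpoly \<Rightarrow> 'n \<Rightarrow> ('n \<Rightarrow> 'n) \<Rightarrow> (('n \<Rightarrow> int) \<times> nat) set" where
  "W_init T s \<sigma> = {(b, r). b s = 0 \<and> r > 0 \<and> (\<forall>k.
     rat_of_nat (min (mdeg k T) (mdeg (inv \<sigma> k) T))
        \<ge> rat_of_nat (mdeg s T) / 2 * rat_of_nat r * rat_of_int \<bar>b k\<bar> \<and>
     rat_of_nat (mdeg s T) / 2 * rat_of_nat r * rat_of_int \<bar>b k\<bar>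
        \<ge> \<bar>rat_of_nat (mdeg k T) - rat_of_nat (mdeg (inv \<sigma> k) T)\<bar>)}"

text \<open>What is removed from \<open>W\<close> once \<open>(b, r)\<close> has been treated. If some \<open>(0, r)\<close> is in \<open>W\<close>, then so are
  all \<open>(0, r')\<close> with \<open>r' > 0\<close>. The exchange polynomials of the seedlets \<open>(0, r, Z)\<close> are the
  constants \<open>Z(1)\<close>, and these do not depend on \<open>r\<close>: they are the integers \<open>\<ge> 2\<close>. So all of them are
  treated at once; otherwise the loop over the infinite set \<open>W\<close> would never end.\<close>

definition treated :: "('n \<Rightarrow> int) \<times> nat \<Rightarrow> (('n \<Rightarrow> int) \<times> nat) set" where
  "treated br = (if fst br = (\<lambda>_. 0) then {(\<lambda>_. 0, r') | r'. True} else {br})"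

type_synonym 'n cs_pairs = "(('n \<Rightarrow> 'n ratfun) \<times> ('n \<Rightarrow> int)) set"

text \<open>A state is a position in the routine together with the current values of its variables, the
  last component being the current value of \<open>M(F)\<close>. \<open>At_2\<close>, \<open>At_a\<close> and \<open>At_A\<close> are the heads of the
  loops over \<open>S\<close>, \<open>\<Sigma>\<^sub>s\<close> and \<open>W\<close>. The choices of \<open>s\<close>, \<open>\<sigma>\<close>, \<open>k0\<close> and \<open>(b, r)\<close> are
  nondeterministic.\<close>

datatype 'n state =
    Start
  | At_2 "'n set" "'n cs_pairs"
  | At_a "'n set" 'n "('n \<Rightarrow> 'n) set" "'n cs_pairs"
  | At_A "'n set" 'n "('n \<Rightarrow> 'n) set" "'n \<Rightarrow> 'n" "'n ratfun" "(('n \<Rightarrow> int) \<times> nat) set" "'n cs_pairs"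
  | Stop "'n cs_pairs"

inductive routine_step ::
    "'n::{finite,linorder} laurent \<Rightarrow> 'n state \<Rightarrow> 'n state \<Rightarrow> bool" for F where
  step_1: "type_rep F T d \<Longrightarrow> routine_step F Start (At_2 (even_dirs T) {})"
| step_2: "routine_step F (At_2 {} M) (Stop M)"
| step_3: "type_rep F T d \<Longrightarrow> s \<in> S \<Longrightarrow>
    routine_step F (At_2 S M) (At_a S s (Sigma_init T s) M)"
| step_a: "routine_step F (At_a S s {} M) (At_2 (S - {s}) M)"
| step_b_pass: "type_rep F T d \<Longrightarrow> \<sigma> \<in> \<Sigma> \<Longrightarrow> mdeg s T = 2 * h \<Longrightarrow>
    expansion s T fs \<Longrightarrow> expansion (inv \<sigma> s) T ft \<Longrightarrow> k0_choice h fs ft k0 \<Longrightarrow>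
    P_passes h fs ft \<sigma> k0 P \<Longrightarrow>
    routine_step F (At_a S s \<Sigma> M) (At_A S s \<Sigma> \<sigma> P (W_init T s \<sigma>) M)"
| step_b_fail: "type_rep F T d \<Longrightarrow> \<sigma> \<in> \<Sigma> \<Longrightarrow> mdeg s T = 2 * h \<Longrightarrow>
    expansion s T fs \<Longrightarrow> expansion (inv \<sigma> s) T ft \<Longrightarrow> k0_choice h fs ft k0 \<Longrightarrow>
    \<nexists>P. P_passes h fs ft \<sigma> k0 P \<Longrightarrow>
    routine_step F (At_a S s \<Sigma> M) (At_a S s (\<Sigma> - {\<sigma>}) M)"
| step_A: "routine_step F (At_A S s \<Sigma> \<sigma> P {} M) (At_a S s (\<Sigma> - {\<sigma>}) M)"
| step_B_found: "type_rep F T d \<Longrightarrow> (b, r) \<in> W \<Longrightarrow>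
    is_seedlet s (b, r, Z) \<Longrightarrow> P = exchange_poly (b, r, Z) \<Longrightarrow>
    routine_step F (At_A S s \<Sigma> \<sigma> P W M)
      (At_A S s \<Sigma> \<sigma> P (W - treated (b, r))
        (M \<union> {(cs_map \<sigma> s (b, r, Z), d') | d'. d' \<in> free_tuples T d s \<sigma>}))"
| step_B_none: "(b, r) \<in> W \<Longrightarrow>
    \<nexists>Z. is_seedlet s (b, r, Z) \<and> P = exchange_poly (b, r, Z) \<Longrightarrow>
    routine_step F (At_A S s \<Sigma> \<sigma> P W M) (At_A S s \<Sigma> \<sigma> P (W - treated (b, r)) M)"

end

theory Submission
  imports Defs
begin

text \<open>
  Write \<open>D = d + d'\<close>, \<open>t = \<sigma>\<^sup>-\<^sup>1(s)\<close> and expand \<open>T\<close> in powers of \<open>x\<^sub>t\<close> and of \<open>x\<^sub>s\<close>. The invariance of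
  \<open>T / x\<^sup>D\<close> under a cluster symmetric map then compares two expansions in powers of \<open>x\<^sub>s\<close> whose
  coefficients do not involve \<open>x\<^sub>s\<close>. Since the extreme coefficients of \<open>T\<close> do not vanish, the ranges of
  exponents force \<open>\<eta>\<^sub>s = \<eta>\<^sub>t = D\<^sub>s + D\<^sub>t\<close>. No variable divides \<open>P\<close> or \<open>T\<close>, so taking the order in
  \<open>x\<^sub>k\<close> of the coefficient identities gives \<open>\<sigma>(D) = D\<close>, and hence \<open>2 D\<^sub>s = \<eta>\<^sub>s\<close>; taking degrees in
  \<open>x\<^sub>k\<close> instead gives the inequalities that define \<open>W\<close>. In particular a pair is trivial iff \<open>\<eta>\<^sub>s = 0\<close>.
  The polynomial \<open>P\<close> is determined by the coefficient identities as a root, because exchange polynomials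
  are positive for an ordering of the field of rational functions.
\<close>

text \<open>The identities contain powers of P with exponents of either sign, so degree and order
  are needed on the field of rational functions. One construction gives both, since an order is a
  degree for negated exponents. Powers of x_s can be compared because nonzero functions free of x_s
  have degree 0 in x_s. The comparison does not see x_s itself: orders in x_k give
  \<open>D (inv \<sigma> k) = D k\<close> only for k other than s. The missing equality follows
  because a permutation does not change the sum of all D_k. The resulting conditions separate into
  one on P and one on d'. With positive roots, a fixed even direction s and a fixed \<sigma> admit
  at most one map, which is paired with every free tuple. Correctness of the inner loop then rests
  on two facts: W contains every relevant (b, r), and one hit is enough. The obstacle to termination
  is b = 0, where W puts no bound on r. There the exchange polynomial is the constant Z(1), and
  every r > 0 produces the same constants, so these entries can be discarded together.\<close>

section \<open>Finite sums of monomials and coefficients of products\<close>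

lemma lookup_sum_single:
  "Poly_Mapping.lookup (\<Sum>i\<in>I. Poly_Mapping.single (\<mu> i) (c i)) m = (\<Sum>i\<in>I. (c i when \<mu> i = m))"
  by (simp add: lookup_sum lookup_single)

lemma sum_single_keys:
  "(\<Sum>m\<in>Poly_Mapping.keys p. Poly_Mapping.single m (Poly_Mapping.lookup p m)) = p"
  by (rule poly_mapping_eqI) (simp add: lookup_sum_single when_def in_keys_iff sum.delta)

lemma lookup_sum_single_inj:
  assumes "finite I" "inj_on \<mu> I" "i \<in> I"
  shows "Poly_Mapping.lookup (\<Sum>i\<in>I. Poly_Mapping.single (\<mu> i) (c i)) (\<mu> i) = c i"
proof -
  have "(\<Sum>j\<in>I. (c j when \<mu> j = \<mu> i)) = (\<Sum>j\<in>I. (c j when j = i))"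
    using assms by (intro sum.cong) (auto simp: when_def inj_on_eq_iff)
  then show ?thesis
    using assms by (simp add: lookup_sum_single when_def sum.delta)
qed

lemma keys_sum_single_subset:
  "Poly_Mapping.keys (\<Sum>i\<in>I. Poly_Mapping.single (\<mu> i) (c i)) \<subseteq> \<mu> ` I"
proof
  fix m assume "m \<in> Poly_Mapping.keys (\<Sum>i\<in>I. Poly_Mapping.single (\<mu> i) (c i))"
  then have "(\<Sum>i\<in>I. (c i when \<mu> i = m)) \<noteq> 0"
    by (simp add: in_keys_iff lookup_sum_single)
  then obtain i where "i \<in> I" "(c i when \<mu> i = m) \<noteq> 0"
    by (rule sum.not_neutral_contains_not_neutral)
  then show "m \<in> \<mu> ` I" by auto
qed

lemma keys_sum_single_inj:
  assumes "finite I" "inj_on \<mu> I" "\<And>i. i \<in> I \<Longrightarrow> c i \<noteq> 0"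
  shows "Poly_Mapping.keys (\<Sum>i\<in>I. Poly_Mapping.single (\<mu> i) (c i)) = \<mu> ` I"
  using keys_sum_single_subset[of \<mu> c I] lookup_sum_single_inj[OF assms(1,2), of _ c] assms(3)
  by (auto simp: in_keys_iff)

lemma mult_as_sum_single:
  "p * q = (\<Sum>a\<in>Poly_Mapping.keys p. \<Sum>b\<in>Poly_Mapping.keys q.
     Poly_Mapping.single (a + b) (Poly_Mapping.lookup p a * Poly_Mapping.lookup q b))"
proof -
  have "p * q = (\<Sum>a\<in>Poly_Mapping.keys p. Poly_Mapping.single a (Poly_Mapping.lookup p a)) *
      (\<Sum>b\<in>Poly_Mapping.keys q. Poly_Mapping.single b (Poly_Mapping.lookup q b))"
    by (simp add: sum_single_keys)
  then show ?thesis by (simp add: sum_product mult_single)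
qed

text \<open>When only one pair of monomials contributes to the exponent A + B, nothing can cancel
  there. It is applied to leading monomials, whose product therefore survives in the product of the
  polynomials.\<close>

lemma lookup_mult_unique:
  assumes "A \<in> Poly_Mapping.keys p" "B \<in> Poly_Mapping.keys q"
    and "\<And>a b. a \<in> Poly_Mapping.keys p \<Longrightarrow> b \<in> Poly_Mapping.keys q \<Longrightarrow> a + b = A + B \<Longrightarrow> a = A \<and> b = B"
  shows "Poly_Mapping.lookup (p * q) (A + B) = Poly_Mapping.lookup p A * Poly_Mapping.lookup q B"
proof -
  let ?f = "\<lambda>a b. Poly_Mapping.lookup p a * Poly_Mapping.lookup q b"
  have "Poly_Mapping.lookup (p * q) (A + B) =
      (\<Sum>a\<in>Poly_Mapping.keys p. \<Sum>b\<in>Poly_Mapping.keys q. (?f a b when a + b = A + B))"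
    by (simp add: mult_as_sum_single lookup_sum lookup_single)
  also have "\<dots> = (\<Sum>a\<in>Poly_Mapping.keys p. if a = A then
      \<Sum>b\<in>Poly_Mapping.keys q. if b = B then ?f A B else 0 else 0)"
  proof (intro sum.cong refl)
    fix a assume a: "a \<in> Poly_Mapping.keys p"
    show "(\<Sum>b\<in>Poly_Mapping.keys q. (?f a b when a + b = A + B)) =
        (if a = A then \<Sum>b\<in>Poly_Mapping.keys q. if b = B then ?f A B else 0 else 0)"
    proof (cases "a = A")
      case True
      then have "a + b = A + B \<longleftrightarrow> b = B" if "b \<in> Poly_Mapping.keys q" for b
        using assms(3)[OF a that] by auto
      then show ?thesis
        unfolding if_P[OF True] using True by (intro sum.cong refl) (simp add: when_def)
    next
      case False
      then have "a + b \<noteq> A + B" if "b \<in> Poly_Mapping.keys q" for b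
        using assms(3)[OF a that] by auto
      with False show ?thesis by simp
    qed
  qed
  also have "\<dots> = ?f A B"
    using assms(1,2) by (simp add: sum.delta)
  finally show ?thesis .
qed

section \<open>Weighted degrees and valuations\<close>

text \<open>Only additivity is asked, and values may be negative, so that the exponent of x_k and
  its negative are both instances. The maximum weight over a polynomial is then a degree or minus an
  order.\<close>

locale weight =
  fixes w :: "('n::{finite,linorder} \<Rightarrow>\<^sub>0 nat) \<Rightarrow> int"
  assumes w_add: "w (a + b) = w a + w b"
begin

lemma w_zero: "w 0 = 0"
  using w_add[of 0 0] by simp

definition wdeg :: "'n mpoly \<Rightarrow> int" where
  "wdeg p = Max (w ` Poly_Mapping.keys p)"

lemma wdeg_ge: "m \<in> Poly_Mapping.keys p \<Longrightarrow> w m \<le> wdeg p"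
  by (simp add: wdeg_def)

lemma wdeg_le: "p \<noteq> 0 \<Longrightarrow> (\<And>m. m \<in> Poly_Mapping.keys p \<Longrightarrow> w m \<le> c) \<Longrightarrow> wdeg p \<le> c"
  by (simp add: wdeg_def)

lemma wdeg_attained: "p \<noteq> 0 \<Longrightarrow> \<exists>m\<in>Poly_Mapping.keys p. w m = wdeg p"
  unfolding wdeg_def by (metis (no_types, lifting) Max_in finite_imageI finite_keys image_iff image_is_empty keys_eq_empty)

lemma wdeg_one: "wdeg 1 = 0"
  by (simp add: wdeg_def w_zero)

text \<open>Ties of \<open>w\<close> are broken by the monomial order, so that a leading monomial is unique.\<close>

lemma leading_monomial:
  assumes "p \<noteq> 0"
  obtains M where "M \<in> Poly_Mapping.keys p" "w M = wdeg p"
    "\<And>m. m \<in> Poly_Mapping.keys p \<Longrightarrow> w m = wdeg p \<Longrightarrow> m \<le> M"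
proof -
  let ?S = "{m \<in> Poly_Mapping.keys p. w m = wdeg p}"
  have "?S \<noteq> {}" using wdeg_attained[OF assms] by auto
  moreover have fin: "finite ?S" by simp
  ultimately have "Max ?S \<in> ?S" by (rule Max_in[rotated])
  with fin that[of "Max ?S"] show ?thesis by auto
qed

text \<open>The upper bound is additivity of the weight. For the lower bound, take in each factor
  the largest monomial of top weight: their product is reached by no other pair, hence is not
  cancelled.\<close>

lemma wdeg_mult:
  assumes "p \<noteq> 0" "q \<noteq> 0"
  shows "wdeg (p * q) = wdeg p + wdeg q"
proof (rule antisym)
  from assms have pq: "p * q \<noteq> 0" by simp
  show "wdeg (p * q) \<le> wdeg p + wdeg q"
  proof (rule wdeg_le[OF pq])
    fix m assume "m \<in> Poly_Mapping.keys (p * q)"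
    then obtain a b where "m = a + b" "a \<in> Poly_Mapping.keys p" "b \<in> Poly_Mapping.keys q"
      using keys_mult[of p q] by auto
    then show "w m \<le> wdeg p + wdeg q"
      using wdeg_ge[of a p] wdeg_ge[of b q] by (simp add: w_add)
  qed
  obtain A where A: "A \<in> Poly_Mapping.keys p" "w A = wdeg p"
    "\<And>m. m \<in> Poly_Mapping.keys p \<Longrightarrow> w m = wdeg p \<Longrightarrow> m \<le> A"
    using leading_monomial[OF assms(1)] by blast
  obtain B where B: "B \<in> Poly_Mapping.keys q" "w B = wdeg q"
    "\<And>m. m \<in> Poly_Mapping.keys q \<Longrightarrow> w m = wdeg q \<Longrightarrow> m \<le> B"
    using leading_monomial[OF assms(2)] by blast
  have "Poly_Mapping.lookup (p * q) (A + B) = Poly_Mapping.lookup p A * Poly_Mapping.lookup q B"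
  proof (rule lookup_mult_unique[OF A(1) B(1)])
    fix a b assume ab: "a \<in> Poly_Mapping.keys p" "b \<in> Poly_Mapping.keys q" "a + b = A + B"
    \<comment> \<open>Neither weight can exceed its maximum, so equality of the sums forces both
      monomials into top weight, where A and B are the largest.\<close>
    have "w a + w b = wdeg p + wdeg q"
      using ab(3) A(2) B(2) by (metis w_add)
    with wdeg_ge[OF ab(1)] wdeg_ge[OF ab(2)] have "w a = wdeg p" "w b = wdeg q" by auto
    with ab A(3) B(3) have le: "a \<le> A" "b \<le> B" by auto
    show "a = A \<and> b = B"
    proof (rule ccontr)
      assume "\<not> (a = A \<and> b = B)"
      with le have "a < A \<or> b < B" by auto
      with le have "a + b < A + B"
        by (auto intro: add_less_le_mono add_le_less_mono)
      with ab(3) show False by simp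
    qed
  qed
  with A(1) B(1) have "A + B \<in> Poly_Mapping.keys (p * q)"
    by (simp add: in_keys_iff)
  from wdeg_ge[OF this] A(2) B(2) show "wdeg p + wdeg q \<le> wdeg (p * q)"
    by (simp add: w_add)
qed

text \<open>Minus a valuation on the fraction field, in the convention where sums are bounded by a
  maximum. Multiplicativity of \<open>wdeg\<close> makes it independent of the representing
  fraction; at 0 no representation qualifies and the value is unspecified.\<close>

definition val :: "'n ratfun \<Rightarrow> int" where
  "val R = (THE z. \<exists>p q. p \<noteq> 0 \<and> q \<noteq> 0 \<and> R = Fract p q \<and> z = wdeg p - wdeg q)"

lemma val_Fract:
  assumes "p \<noteq> 0" "q \<noteq> 0"
  shows "val (Fract p q) = wdeg p - wdeg q"
  unfolding val_def
proof (rule the_equality)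
  show "\<exists>p' q'. p' \<noteq> 0 \<and> q' \<noteq> 0 \<and> Fract p q = Fract p' q' \<and> wdeg p - wdeg q = wdeg p' - wdeg q'"
    using assms by blast
  fix z assume "\<exists>p' q'. p' \<noteq> 0 \<and> q' \<noteq> 0 \<and> Fract p q = Fract p' q' \<and> z = wdeg p' - wdeg q'"
  then obtain p' q' where *: "p' \<noteq> 0" "q' \<noteq> 0" "Fract p q = Fract p' q'" "z = wdeg p' - wdeg q'"
    by blast
  then have "p * q' = p' * q" using assms by (simp add: eq_fract)
  then have "wdeg p + wdeg q' = wdeg p' + wdeg q"
    using assms * by (metis wdeg_mult)
  with *(4) show "z = wdeg p - wdeg q" by simp
qed

lemma Fract_obtain:
  assumes "(R :: 'n ratfun) \<noteq> 0"
  obtains p q where "R = Fract p q" "p \<noteq> 0" "q \<noteq> 0"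
  using assms by (cases R rule: Fract_cases_nonzero) auto

lemma val_mult:
  assumes "R \<noteq> 0" "S \<noteq> 0"
  shows "val (R * S) = val R + val S"
proof -
  obtain p q where R: "R = Fract p q" "p \<noteq> 0" "q \<noteq> 0" using Fract_obtain[OF assms(1)] .
  obtain p' q' where S: "S = Fract p' q'" "p' \<noteq> 0" "q' \<noteq> 0" using Fract_obtain[OF assms(2)] .
  show ?thesis using R S by (simp add: val_Fract wdeg_mult)
qed

lemma val_one: "val 1 = 0"
  by (simp add: One_fract_def val_Fract)

lemma val_inverse: "R \<noteq> 0 \<Longrightarrow> val (inverse R) = - val R"
  using val_mult[of R "inverse R"] by (simp add: val_one)

lemma val_divide: "R \<noteq> 0 \<Longrightarrow> S \<noteq> 0 \<Longrightarrow> val (R / S) = val R - val S"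
  by (simp add: divide_inverse val_mult val_inverse)

lemma val_power: "R \<noteq> 0 \<Longrightarrow> val (R ^ k) = int k * val R"
  by (induction k) (simp_all add: val_one val_mult algebra_simps)

lemma val_powi: "R \<noteq> 0 \<Longrightarrow> val (R powi k) = k * val R"
  by (cases "0 \<le> k") (simp_all add: power_int_def val_power val_inverse)

lemma val_prod: "(\<And>i. i \<in> I \<Longrightarrow> f i \<noteq> 0) \<Longrightarrow> val (\<Prod>i\<in>I. f i) = (\<Sum>i\<in>I. val (f i))"
  by (induction I rule: infinite_finite_induct) (simp_all add: val_one val_mult)

text \<open>R and -R have the same square, and an integer is determined by its double.\<close>

lemma val_minus: "val (- R) = val R"
proof (cases "R = 0")
  case False
  then have "- R \<noteq> 0" by simp
  have "val R + val R = val (R * R)" by (rule val_mult[symmetric]) fact+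
  also have "R * R = (- R) * (- R)" by (rule minus_mult_minus[symmetric])
  also have "val \<dots> = val (- R) + val (- R)" by (rule val_mult) fact+
  finally show ?thesis by linarith
qed simp

text \<open>Over a common denominator this is the bound for numerators. A free bound c, with
  hypotheses on nonzero summands only, replaces the maximum of the two values because
  \<open>val 0\<close> carries no information.\<close>

lemma val_add_le:
  assumes "R \<noteq> 0 \<Longrightarrow> val R \<le> c" "S \<noteq> 0 \<Longrightarrow> val S \<le> c" "R + S \<noteq> 0"
  shows "val (R + S) \<le> c"
proof (cases "R = 0 \<or> S = 0")
  case False
  obtain p q where R: "R = Fract p q" "p \<noteq> 0" "q \<noteq> 0" using Fract_obtain[of R] False by blast
  obtain p' q' where S: "S = Fract p' q'" "p' \<noteq> 0" "q' \<noteq> 0" using Fract_obtain[of S] False by blast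
  have RS: "R + S = Fract (p * q' + p' * q) (q * q')" using R S by simp
  with assms(3) have nz: "p * q' + p' * q \<noteq> 0" by (auto simp: fract_collapse)
  have "wdeg p - wdeg q \<le> c" "wdeg p' - wdeg q' \<le> c"
    using assms(1,2) False R S by (auto simp: val_Fract)
  moreover have "wdeg (p * q' + p' * q) \<le> max (wdeg (p * q')) (wdeg (p' * q))"
  proof (rule wdeg_le[OF nz])
    fix m assume "m \<in> Poly_Mapping.keys (p * q' + p' * q)"
    then have "m \<in> Poly_Mapping.keys (p * q') \<or> m \<in> Poly_Mapping.keys (p' * q)"
      by (rule set_mp[OF keys_add, THEN UnE]) auto
    then show "w m \<le> max (wdeg (p * q')) (wdeg (p' * q))"
      using wdeg_ge[of m "p * q'"] wdeg_ge[of m "p' * q"] by auto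
  qed
  ultimately show ?thesis
    using R S nz by (simp add: RS val_Fract wdeg_mult)
qed (use assms in auto)

lemma val_sum_le:
  assumes "\<And>i. i \<in> I \<Longrightarrow> f i \<noteq> 0 \<Longrightarrow> val (f i) \<le> c" "(\<Sum>i\<in>I. f i) \<noteq> 0"
  shows "val (\<Sum>i\<in>I. f i) \<le> c"
  using assms
proof (induction I rule: infinite_finite_induct)
  case (insert i I)
  then show ?case
    by (auto intro!: val_add_le)
qed simp_all

text \<open>The term of largest value cannot be cancelled: values are integers, so all other terms,
  and hence their sum if nonzero, lie at least 1 below it.\<close>

lemma sum_neq_0_if_distinct_val:
  assumes "finite I" "I \<noteq> {}" "\<And>i. i \<in> I \<Longrightarrow> f i \<noteq> 0" "inj_on (\<lambda>i. val (f i)) I"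
  shows "(\<Sum>i\<in>I. f i) \<noteq> 0"
proof
  assume 0: "(\<Sum>i\<in>I. f i) = 0"
  let ?V = "(\<lambda>i. val (f i)) ` I"
  have "Max ?V \<in> ?V" using assms by (intro Max_in) auto
  then obtain j where j: "j \<in> I" "val (f j) = Max ?V" by auto
  have less: "val (f i) \<le> val (f j) - 1" if "i \<in> I - {j}" for i
  proof -
    have "val (f i) \<le> val (f j)" using that j(2) assms(1) by simp
    moreover have "val (f i) \<noteq> val (f j)"
      using that j(1) assms(4) by (auto dest: inj_onD)
    ultimately show ?thesis by simp
  qed
  have "(\<Sum>i\<in>I - {j}. f i) = - f j"
    using 0 assms(1) j(1) by (simp add: sum.remove eq_neg_iff_add_eq_0 add.commute)
  moreover from this have "val (\<Sum>i\<in>I - {j}. f i) \<le> val (f j) - 1"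
    using assms(3)[OF j(1)] less by (intro val_sum_le) auto
  ultimately show False by (simp add: val_minus)
qed

end

definition deg_wt :: "'n \<Rightarrow> ('n \<Rightarrow>\<^sub>0 nat) \<Rightarrow> int" where
  "deg_wt k m = int (Poly_Mapping.lookup m k)"

text \<open>The sign turns a least exponent into a maximum: \<open>ord.wdeg k p\<close> is minus the
  multiplicity of x_k in p for p nonzero.\<close>

definition ord_wt :: "'n \<Rightarrow> ('n \<Rightarrow>\<^sub>0 nat) \<Rightarrow> int" where
  "ord_wt k m = - int (Poly_Mapping.lookup m k)"

interpretation deg: weight "deg_wt k" for k
  by unfold_locales (simp add: deg_wt_def lookup_add)

interpretation ord: weight "ord_wt k" for k
  by unfold_locales (simp add: ord_wt_def lookup_add)

section \<open>Evaluation\<close>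

lemma Fract_sum: "(\<Sum>i\<in>I. Fract (f i) 1) = Fract (\<Sum>i\<in>I. f i) 1"
  by (induction I rule: infinite_finite_induct) (simp_all add: Zero_fract_def)

lemma Fract_prod: "(\<Prod>i\<in>I. Fract (f i) 1) = Fract (\<Prod>i\<in>I. f i) 1"
  by (induction I rule: infinite_finite_induct) (simp_all add: One_fract_def)

lemma Fract_power: "Fract p 1 ^ k = Fract (p ^ k) 1"
  by (induction k) (simp_all add: One_fract_def)

lemma ratconst_0 [simp]: "ratconst 0 = 0"
  by (simp add: ratconst_def fract_collapse)

lemma ratconst_1 [simp]: "ratconst 1 = 1"
  by (simp add: ratconst_def fract_collapse)

lemma ratconst_add: "ratconst (a + b) = ratconst a + ratconst b"
  by (simp add: ratconst_def single_add)

lemma ratconst_mult: "ratconst (a * b) = ratconst a * ratconst b"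
  by (simp add: ratconst_def mult_single)

lemma ratconst_of_nat: "ratconst (of_nat k) = of_nat k"
  by (simp add: ratconst_def of_nat_fract)

definition monom_pow :: "('n::{finite,linorder} \<Rightarrow> 'n ratfun) \<Rightarrow> ('n \<Rightarrow>\<^sub>0 nat) \<Rightarrow> 'n ratfun" where
  "monom_pow v m = (\<Prod>i\<in>UNIV. v i ^ Poly_Mapping.lookup m i)"

lemma monom_pow_add: "monom_pow v (m + m') = monom_pow v m * monom_pow v m'"
  by (simp add: monom_pow_def lookup_add power_add prod.distrib)

lemma monom_pow_single: "monom_pow v (Poly_Mapping.single i k) = v i ^ k"
proof -
  have "monom_pow v (Poly_Mapping.single i k) = (\<Prod>j\<in>UNIV. if j = i then v i ^ k else 1)"
    unfolding monom_pow_def by (intro prod.cong) (auto simp: lookup_single when_def)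
  then show ?thesis by simp
qed

text \<open>Cancellation can make the support of p + q smaller than the union of the supports;
  summing over a common larger set makes additivity a termwise matter.\<close>

lemma poly_at_superset:
  assumes "finite A" "Poly_Mapping.keys p \<subseteq> A"
  shows "poly_at p v = (\<Sum>m\<in>A. ratconst (Poly_Mapping.lookup p m) * monom_pow v m)"
  unfolding poly_at_def monom_pow_def
  using assms by (intro sum.mono_neutral_left) (auto simp: in_keys_iff)

lemma poly_at_0 [simp]: "poly_at 0 v = 0"
  by (simp add: poly_at_def)

lemma poly_at_add: "poly_at (p + q) v = poly_at p v + poly_at q v"
proof -
  let ?A = "Poly_Mapping.keys p \<union> Poly_Mapping.keys q"
  have "finite ?A" "Poly_Mapping.keys (p + q) \<subseteq> ?A" by (simp_all add: keys_add)
  then show ?thesis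
    using poly_at_superset[of ?A "p + q" v] poly_at_superset[of ?A p v] poly_at_superset[of ?A q v]
    by (simp add: lookup_add ratconst_add algebra_simps sum.distrib)
qed

lemma poly_at_sum: "poly_at (\<Sum>i\<in>I. f i) v = (\<Sum>i\<in>I. poly_at (f i) v)"
  by (induction I rule: infinite_finite_induct) (simp_all add: poly_at_add)

lemma poly_at_single: "poly_at (Poly_Mapping.single m c) v = ratconst c * monom_pow v m"
  using poly_at_superset[of "{m}" "Poly_Mapping.single m c" v] by simp

lemma poly_at_mult: "poly_at (p * q) v = poly_at p v * poly_at q v"
proof -
  have "poly_at (p * q) v = (\<Sum>a\<in>Poly_Mapping.keys p. \<Sum>b\<in>Poly_Mapping.keys q.
      (ratconst (Poly_Mapping.lookup p a) * monom_pow v a) *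
      (ratconst (Poly_Mapping.lookup q b) * monom_pow v b))"
    by (simp add: mult_as_sum_single poly_at_sum poly_at_single ratconst_mult monom_pow_add ac_simps)
  then show ?thesis
    by (simp add: sum_product[symmetric] poly_at_superset[OF finite_keys order_refl])
qed

lemma poly_at_1: "poly_at 1 v = 1"
  using poly_at_single[of 0 1 v] by (simp add: monom_pow_def)

lemma poly_at_pvar: "poly_at (pvar i) v = v i"
  by (simp add: pvar_def poly_at_single monom_pow_single)

lemma poly_at_power: "poly_at (p ^ k) v = poly_at p v ^ k"
  by (induction k) (simp_all add: poly_at_1 poly_at_mult)

lemma pvar_power: "pvar i ^ k = Poly_Mapping.single (Poly_Mapping.single i k) 1"
  by (induction k) (simp_all add: pvar_def mult_single flip: single_add)

lemma sum_single_lookup: "(\<Sum>i\<in>UNIV. Poly_Mapping.single i (Poly_Mapping.lookup m i)) = (m :: 'n::finite \<Rightarrow>\<^sub>0 nat)"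
  by (rule poly_mapping_eqI) (simp add: lookup_sum_single when_def)

lemma prod_single: "finite I \<Longrightarrow> (\<Prod>i\<in>I. Poly_Mapping.single (f i) (1::rat)) = Poly_Mapping.single (\<Sum>i\<in>I. f i) 1"
  by (induction I rule: finite_induct) (simp_all add: mult_single)

lemma monom_pow_X: "monom_pow X m = Fract (Poly_Mapping.single m 1) 1"
proof -
  have "monom_pow X m = (\<Prod>i\<in>UNIV. Fract (Poly_Mapping.single (Poly_Mapping.single i (Poly_Mapping.lookup m i)) 1) 1)"
    by (simp add: monom_pow_def X_def Fract_power pvar_power)
  then show ?thesis
    by (simp add: Fract_prod prod_single sum_single_lookup)
qed

lemma ratconst_mult_Fract_single:
  "ratconst c * Fract (Poly_Mapping.single m 1) 1 = Fract (Poly_Mapping.single m c) 1"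
  by (simp add: ratconst_def mult_single)

lemma poly_at_X: "poly_at p X = Fract p 1"
  by (simp add: poly_at_superset[OF finite_keys order_refl] monom_pow_X ratconst_mult_Fract_single
      Fract_sum sum_single_keys)

lemma single_eq_0_iff: "Poly_Mapping.single k a = 0 \<longleftrightarrow> a = 0"
  by (metis lookup_single_eq lookup_zero single_zero)

lemma X_neq_0 [simp]: "X i \<noteq> 0"
  by (simp add: X_def pvar_def Zero_fract_def eq_fract single_eq_0_iff)

lemma Fract_1_eq_0_iff: "Fract p 1 = 0 \<longleftrightarrow> p = 0"
  by (simp add: Zero_fract_def eq_fract)

lemma poly_at_X_eq_0_iff: "poly_at p X = 0 \<longleftrightarrow> p = 0"
  by (simp add: poly_at_X Fract_1_eq_0_iff)

text \<open>Substituting x_{\<sigma>(i)} for x_i moves the exponent at i to \<sigma>(i), so the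
  exponent at k is found at \<open>inv \<sigma> k\<close>.\<close>

definition perm_monom :: "('n \<Rightarrow> 'n) \<Rightarrow> ('n::finite \<Rightarrow>\<^sub>0 nat) \<Rightarrow> ('n \<Rightarrow>\<^sub>0 nat)" where
  "perm_monom \<sigma> m = Abs_poly_mapping (\<lambda>k. Poly_Mapping.lookup m (inv \<sigma> k))"

lemma lookup_perm_monom [simp]:
  "Poly_Mapping.lookup (perm_monom \<sigma> m) k = Poly_Mapping.lookup m (inv \<sigma> k)"
  by (simp add: perm_monom_def)

lemma inj_perm_monom: "bij \<sigma> \<Longrightarrow> inj (perm_monom \<sigma>)"
  by (rule injI, rule poly_mapping_eqI) (metis bij_inv_eq_iff lookup_perm_monom)

definition perm_poly :: "('n \<Rightarrow> 'n) \<Rightarrow> 'n::{finite,linorder} mpoly \<Rightarrow> 'n mpoly" where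
  "perm_poly \<sigma> p = (\<Sum>m\<in>Poly_Mapping.keys p.
     Poly_Mapping.single (perm_monom \<sigma> m) (Poly_Mapping.lookup p m))"

lemma keys_perm_poly: "bij \<sigma> \<Longrightarrow> Poly_Mapping.keys (perm_poly \<sigma> p) = perm_monom \<sigma> ` Poly_Mapping.keys p"
  unfolding perm_poly_def
  by (intro keys_sum_single_inj) (auto simp: in_keys_iff intro: inj_on_subset[OF inj_perm_monom])

lemma perm_poly_eq_0_iff: "bij \<sigma> \<Longrightarrow> perm_poly \<sigma> p = 0 \<longleftrightarrow> p = 0"
  by (metis keys_perm_poly image_is_empty keys_eq_empty)

lemma monom_pow_perm:
  assumes "bij \<sigma>"
  shows "monom_pow (v \<circ> \<sigma>) m = monom_pow v (perm_monom \<sigma> m)"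
proof -
  have "monom_pow v (perm_monom \<sigma> m) = (\<Prod>i\<in>UNIV. v (\<sigma> i) ^ Poly_Mapping.lookup m (inv \<sigma> (\<sigma> i)))"
    unfolding monom_pow_def lookup_perm_monom
    by (rule prod.reindex_bij_betw[symmetric]) (rule assms)
  then show ?thesis
    using assms by (simp add: monom_pow_def bij_is_inj)
qed

lemma poly_at_perm:
  assumes "bij \<sigma>"
  shows "poly_at p (X \<circ> \<sigma>) = Fract (perm_poly \<sigma> p) 1"
  by (simp add: poly_at_superset[OF finite_keys order_refl] monom_pow_perm[OF assms] monom_pow_X
      ratconst_mult_Fract_single Fract_sum perm_poly_def)

lemma poly_at_perm_eq_0_iff: "bij \<sigma> \<Longrightarrow> poly_at p (X \<circ> \<sigma>) = 0 \<longleftrightarrow> p = 0"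
  by (simp add: poly_at_perm Fract_1_eq_0_iff perm_poly_eq_0_iff)

section \<open>Laurent monomials and Laurent polynomials at nonzero tuples\<close>

lemma monom_at_add:
  assumes "\<And>i. v i \<noteq> 0"
  shows "monom_at v (\<lambda>i. d i + e i) = monom_at v d * monom_at v e"
  using assms by (simp add: monom_at_def power_int_add prod.distrib)

lemma monom_at_uminus: "monom_at v (\<lambda>i. - d i) = inverse (monom_at v d)"
  by (simp add: monom_at_def power_int_minus prod_inversef[symmetric] o_def)

lemma monom_at_neq_0: "(\<And>i. v i \<noteq> 0) \<Longrightarrow> monom_at v d \<noteq> 0"
  by (simp add: monom_at_def)

lemma laurent_at_superset:
  assumes "finite A" "Poly_Mapping.keys F \<subseteq> A"
  shows "laurent_at F v = (\<Sum>m\<in>A. ratconst (Poly_Mapping.lookup F m) * monom_at v (Poly_Mapping.lookup m))"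
  unfolding laurent_at_def
  using assms by (intro sum.mono_neutral_left) (auto simp: in_keys_iff)

lemma laurent_at_0 [simp]: "laurent_at 0 v = 0"
  by (simp add: laurent_at_def)

lemma laurent_at_add: "laurent_at (p + q) v = laurent_at p v + laurent_at q v"
proof -
  let ?A = "Poly_Mapping.keys p \<union> Poly_Mapping.keys q"
  have "finite ?A" "Poly_Mapping.keys (p + q) \<subseteq> ?A" by (simp_all add: keys_add)
  then show ?thesis
    using laurent_at_superset[of ?A "p + q" v] laurent_at_superset[of ?A p v] laurent_at_superset[of ?A q v]
    by (simp add: lookup_add ratconst_add algebra_simps sum.distrib)
qed

lemma laurent_at_sum: "laurent_at (\<Sum>i\<in>I. f i) v = (\<Sum>i\<in>I. laurent_at (f i) v)"
  by (induction I rule: infinite_finite_induct) (simp_all add: laurent_at_add)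

lemma laurent_at_single:
  "laurent_at (Poly_Mapping.single m c) v = ratconst c * monom_at v (Poly_Mapping.lookup m)"
  using laurent_at_superset[of "{m}" "Poly_Mapping.single m c" v] by simp

lemma laurent_at_monom_mult:
  assumes "\<And>i. v i \<noteq> 0"
  shows "laurent_at (laurent_monom e * F) v = monom_at v e * laurent_at F v"
proof -
  have "laurent_monom e * F = (\<Sum>m\<in>Poly_Mapping.keys F.
      Poly_Mapping.single (Abs_poly_mapping e + m) (Poly_Mapping.lookup F m))"
  proof -
    have "laurent_monom e * F = laurent_monom e *
        (\<Sum>m\<in>Poly_Mapping.keys F. Poly_Mapping.single m (Poly_Mapping.lookup F m))"
      by (simp add: sum_single_keys)
    then show ?thesis by (simp add: laurent_monom_def sum_distrib_left mult_single)
  qed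
  moreover have "monom_at v (Poly_Mapping.lookup (Abs_poly_mapping e + m)) =
      monom_at v e * monom_at v (Poly_Mapping.lookup m)" for m
    using monom_at_add[of v e "Poly_Mapping.lookup m", OF assms] by (simp add: lookup_add[abs_def])
  ultimately show ?thesis
    by (simp add: laurent_at_sum laurent_at_single laurent_at_def[of F] sum_distrib_left mult.left_commute)
qed

section \<open>Types of Laurent polynomials\<close>

lemma pvar_dvd_if_keys:
  assumes "\<And>m. m \<in> Poly_Mapping.keys p \<Longrightarrow> Poly_Mapping.lookup m k \<noteq> 0"
  shows "pvar k dvd p"
proof
  let ?e = "Poly_Mapping.single k (1::nat)"
  have "pvar k * (\<Sum>m\<in>Poly_Mapping.keys p. Poly_Mapping.single (m - ?e) (Poly_Mapping.lookup p m)) =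
      (\<Sum>m\<in>Poly_Mapping.keys p. Poly_Mapping.single (?e + (m - ?e)) (Poly_Mapping.lookup p m))"
    by (simp add: sum_distrib_left pvar_def mult_single)
  also have "\<dots> = (\<Sum>m\<in>Poly_Mapping.keys p. Poly_Mapping.single m (Poly_Mapping.lookup p m))"
  proof (intro sum.cong refl arg_cong2[where f = Poly_Mapping.single])
    fix m assume "m \<in> Poly_Mapping.keys p"
    \<comment> \<open>The truncated subtraction is exact because the exponent of x_k in m is at
      least 1.\<close>
    from assms[OF this] show "?e + (m - ?e) = m"
      by (intro poly_mapping_eqI) (auto simp: lookup_add lookup_minus lookup_single when_def)
  qed
  finally show "p = pvar k * (\<Sum>m\<in>Poly_Mapping.keys p.
      Poly_Mapping.single (m - ?e) (Poly_Mapping.lookup p m))"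
    by (simp add: sum_single_keys)
qed

lemma not_pvar_dvdD:
  assumes "\<not> pvar k dvd p"
  obtains m where "m \<in> Poly_Mapping.keys p" "Poly_Mapping.lookup m k = 0"
  using pvar_dvd_if_keys[of p k] assms by blast

lemma not_pvar_dvdI:
  fixes k :: "'n::{finite,linorder}"
  assumes "m \<in> Poly_Mapping.keys p" "Poly_Mapping.lookup m k = 0"
  shows "\<not> pvar k dvd p"
proof
  assume "pvar k dvd p"
  then obtain q where q: "p = pvar k * q" by (elim dvdE)
  have "m \<in> Poly_Mapping.keys (pvar k * q)" using assms(1) q by simp
  then obtain a b where "m = a + b" "a \<in> Poly_Mapping.keys (pvar k :: 'n mpoly)"
    using keys_mult[of "pvar k" q] by auto
  with assms(2) show False
    by (auto simp: pvar_def lookup_add)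
qed

lemma ord_wdeg_eq_0:
  assumes "\<not> pvar k dvd p"
  shows "ord.wdeg k p = 0"
proof (rule antisym)
  have "p \<noteq> 0" using assms by auto
  then show "ord.wdeg k p \<le> 0" by (rule ord.wdeg_le) (simp add: ord_wt_def)
  obtain m where "m \<in> Poly_Mapping.keys p" "Poly_Mapping.lookup m k = 0"
    using not_pvar_dvdD[OF assms] .
  then show "0 \<le> ord.wdeg k p"
    using ord.wdeg_ge[of m p k] by (simp add: ord_wt_def)
qed

lemma deg_wdeg_eq_mdeg:
  assumes "p \<noteq> 0"
  shows "deg.wdeg k p = int (mdeg k p)"
proof (rule antisym)
  show "deg.wdeg k p \<le> int (mdeg k p)"
    using assms by (rule deg.wdeg_le) (simp add: deg_wt_def mdeg_def)
  have "Max (insert 0 ((\<lambda>m. Poly_Mapping.lookup m k) ` Poly_Mapping.keys p)) \<le> nat (deg.wdeg k p)"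
  proof (rule Max.boundedI)
    fix a assume "a \<in> insert 0 ((\<lambda>m. Poly_Mapping.lookup m k) ` Poly_Mapping.keys p)"
    then show "a \<le> nat (deg.wdeg k p)"
      using deg.wdeg_ge[of _ p k] by (fastforce simp: deg_wt_def)
  qed auto
  moreover have "0 \<le> deg.wdeg k p"
    using deg.wdeg_attained[OF assms, of k] by (auto simp: deg_wt_def)
  ultimately show "int (mdeg k p) \<le> deg.wdeg k p"
    by (simp only: mdeg_def le_nat_iff)
qed

lemma val_X:
  fixes w :: "('n::{finite,linorder} \<Rightarrow>\<^sub>0 nat) \<Rightarrow> int"
  assumes "weight w"
  shows "weight.val w (X i) = w (Poly_Mapping.single i 1)"
proof -
  interpret weight w by fact
  show ?thesis
    by (simp add: X_def pvar_def val_Fract single_eq_0_iff wdeg_one) (simp add: wdeg_def)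
qed

lemma ord_val_X: "ord.val k (X i) = (if i = k then -1 else 0)"
  by (simp add: val_X[OF ord.weight_axioms] ord_wt_def lookup_single when_def)

lemma deg_val_X: "deg.val k (X i) = (if i = k then 1 else 0)"
  by (simp add: val_X[OF deg.weight_axioms] deg_wt_def lookup_single when_def)

lemma ord_val_monom_at: "ord.val k (monom_at X d) = - d k"
  by (simp add: monom_at_def ord.val_prod ord.val_powi ord_val_X if_distrib[of "(*) _"] cong: if_cong)

text \<open>Since x_k does not divide T, the order of F in x_k reads off d_k. Once the denominators
  agree, the numerators do.\<close>

lemma type_rep_unique:
  assumes "type_rep F T d" "type_rep F T' d'"
  shows "T = T' \<and> d = d'"
proof -
  have nd: "\<not> pvar k dvd T" "\<not> pvar k dvd T'" for k
    using assms by (auto simp: type_rep_def)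
  then have nz: "T \<noteq> 0" "T' \<noteq> 0" by auto
  have eq: "Fract T 1 / monom_at X d = Fract T' 1 / monom_at X d'"
    using assms by (simp add: type_rep_def poly_at_X)
  have "d k = d' k" for k
  proof -
    have "ord.val k (Fract T 1 / monom_at X d) = d k"
      using nz by (simp add: ord.val_divide monom_at_neq_0 Fract_1_eq_0_iff ord.val_Fract
          ord_wdeg_eq_0[OF nd(1)] ord.wdeg_one ord_val_monom_at)
    moreover have "ord.val k (Fract T' 1 / monom_at X d') = d' k"
      using nz by (simp add: ord.val_divide monom_at_neq_0 Fract_1_eq_0_iff ord.val_Fract
          ord_wdeg_eq_0[OF nd(2)] ord.wdeg_one ord_val_monom_at)
    ultimately show ?thesis using eq by simp
  qed
  then have "d = d'" by auto
  with eq show ?thesis by (simp add: monom_at_neq_0 eq_fract)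
qed

text \<open>The factorization comes from shifting exponents, so it holds at every tuple of nonzero
  functions and not only at X. This is what permits substituting a cluster symmetric map.\<close>

lemma type_rep_exists_general:
  fixes F :: "'n::{finite,linorder} laurent"
  assumes "F \<noteq> 0"
  obtains T d where "type_rep F T d"
    "\<And>v. (\<And>i. v i \<noteq> 0) \<Longrightarrow> laurent_at F v = poly_at T v / monom_at v d"
proof -
  let ?K = "Poly_Mapping.keys F"
  \<comment> \<open>Minus the least exponent of x_i in F: the shifted exponents are nonnegative, and
    0 is attained for each i, which keeps x_i from dividing T.\<close>
  define d where "d = (\<lambda>i. - Min ((\<lambda>m. Poly_Mapping.lookup m i) ` ?K))"
  define \<mu> where "\<mu> = (\<lambda>m :: 'n \<Rightarrow>\<^sub>0 int. Abs_poly_mapping (\<lambda>i. nat (Poly_Mapping.lookup m i + d i)))"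
  define T where "T = (\<Sum>m\<in>?K. Poly_Mapping.single (\<mu> m) (Poly_Mapping.lookup F m))"
  have K: "?K \<noteq> {}" using assms by simp
  have ge0: "0 \<le> Poly_Mapping.lookup m i + d i" if "m \<in> ?K" for m i
    using that by (simp add: d_def)
  have lookup_\<mu>: "Poly_Mapping.lookup (\<mu> m) i = nat (Poly_Mapping.lookup m i + d i)" for m i
    by (simp add: \<mu>_def)
  have "inj_on \<mu> ?K"
  proof (rule inj_onI, rule poly_mapping_eqI)
    fix a b i assume *: "a \<in> ?K" "b \<in> ?K" "\<mu> a = \<mu> b"
    then have "Poly_Mapping.lookup (\<mu> a) i = Poly_Mapping.lookup (\<mu> b) i" by simp
    then show "Poly_Mapping.lookup a i = Poly_Mapping.lookup b i"
      using ge0[OF *(1), of i] ge0[OF *(2), of i] by (simp add: lookup_\<mu>)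
  qed
  then have keys_T: "Poly_Mapping.keys T = \<mu> ` ?K"
    unfolding T_def by (intro keys_sum_single_inj) (auto simp: in_keys_iff)
  have at: "laurent_at F v = poly_at T v / monom_at v d" if v: "\<And>i. v i \<noteq> 0" for v
  proof -
    have "monom_pow v (\<mu> m) = monom_at v (Poly_Mapping.lookup m) * monom_at v d" if "m \<in> ?K" for m
    proof -
      have "monom_pow v (\<mu> m) = monom_at v (\<lambda>i. Poly_Mapping.lookup m i + d i)"
        unfolding monom_pow_def monom_at_def
        using ge0[OF that] by (intro prod.cong refl) (simp add: lookup_\<mu> power_int_def)
      then show ?thesis using monom_at_add[OF v] by simp
    qed
    then show ?thesis
      unfolding T_def poly_at_sum laurent_at_def
      by (simp add: poly_at_single sum_divide_distrib monom_at_neq_0[OF v])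
  qed
  have "\<not> pvar i dvd T" for i
  proof -
    have "Min ((\<lambda>m. Poly_Mapping.lookup m i) ` ?K) \<in> (\<lambda>m. Poly_Mapping.lookup m i) ` ?K"
      using K by (intro Min_in) auto
    then obtain m where m: "m \<in> ?K" "Poly_Mapping.lookup m i = - d i"
      by (auto simp: d_def)
    show ?thesis
      by (rule not_pvar_dvdI[of "\<mu> m"]) (use m in \<open>auto simp: keys_T lookup_\<mu>\<close>)
  qed
  then have "type_rep F T d"
    using at[of X] by (simp add: type_rep_def)
  with at that show ?thesis by blast
qed

text \<open>\<open>type_rep\<close> speaks of values at X only. By uniqueness (T, d) is the pair
  constructed from the exponents of F, for which the identity is known at all nonzero
  tuples.\<close>

lemma laurent_at_type_rep:
  assumes "type_rep F T d" "\<And>i. v i \<noteq> 0"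
  shows "laurent_at F v = poly_at T v / monom_at v d"
proof -
  have "F \<noteq> 0"
  proof
    assume "F = 0"
    with assms(1) have "T = 0"
      by (simp add: type_rep_def poly_at_X_eq_0_iff monom_at_neq_0)
    with assms(1) show False by (simp add: type_rep_def)
  qed
  then show ?thesis
    using type_rep_exists_general[of F] type_rep_unique[OF assms(1)] assms(2) by metis
qed

section \<open>Coefficients with respect to one variable\<close>

text \<open>The coefficient of x_s^i, defined for every i and equal to 0 beyond the degree. The
  relation \<open>expansion\<close> leaves its functions arbitrary there, so a canonical choice is
  needed to compare ranges of exponents.\<close>

definition coefp :: "'n \<Rightarrow> nat \<Rightarrow> 'n mpoly \<Rightarrow> 'n mpoly" where
  "coefp s i p = (\<Sum>m\<in>{m \<in> Poly_Mapping.keys p. Poly_Mapping.lookup m s = i}.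
     Poly_Mapping.single (m - Poly_Mapping.single s i) (Poly_Mapping.lookup p m))"

lemma monom_split:
  fixes m :: "'n \<Rightarrow>\<^sub>0 nat"
  shows "Poly_Mapping.lookup m s = i \<Longrightarrow> m - Poly_Mapping.single s i + Poly_Mapping.single s i = m"
  by (rule poly_mapping_eqI) (auto simp: lookup_add lookup_minus lookup_single when_def)

lemma keys_coefp:
  "Poly_Mapping.keys (coefp s i p) =
     (\<lambda>m. m - Poly_Mapping.single s i) ` {m \<in> Poly_Mapping.keys p. Poly_Mapping.lookup m s = i}"
  unfolding coefp_def
proof (rule keys_sum_single_inj)
  show "inj_on (\<lambda>m. m - Poly_Mapping.single s i) {m \<in> Poly_Mapping.keys p. Poly_Mapping.lookup m s = i}"
  proof (rule inj_onI)
    fix a b assume *: "a \<in> {m \<in> Poly_Mapping.keys p. Poly_Mapping.lookup m s = i}"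
      "b \<in> {m \<in> Poly_Mapping.keys p. Poly_Mapping.lookup m s = i}"
      "a - Poly_Mapping.single s i = b - Poly_Mapping.single s i"
    have "a = a - Poly_Mapping.single s i + Poly_Mapping.single s i"
      using *(1) by (intro monom_split[symmetric]) simp
    also have "\<dots> = b - Poly_Mapping.single s i + Poly_Mapping.single s i"
      by (simp only: *(3))
    also have "\<dots> = b"
      using *(2) by (intro monom_split) simp
    finally show "a = b" .
  qed
qed (auto simp: in_keys_iff)

lemma keys_coefp_lookup_0: "m \<in> Poly_Mapping.keys (coefp s i p) \<Longrightarrow> Poly_Mapping.lookup m s = 0"
  by (auto simp: keys_coefp lookup_minus)

lemma coefp_eq_0_iff:
  "coefp s i p = 0 \<longleftrightarrow> (\<forall>m\<in>Poly_Mapping.keys p. Poly_Mapping.lookup m s \<noteq> i)"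
proof -
  have "coefp s i p = 0 \<longleftrightarrow> Poly_Mapping.keys (coefp s i p) = {}" by simp
  also have "\<dots> \<longleftrightarrow> (\<forall>m\<in>Poly_Mapping.keys p. Poly_Mapping.lookup m s \<noteq> i)"
    unfolding keys_coefp by auto
  finally show ?thesis .
qed

lemma lookup_le_mdeg: "m \<in> Poly_Mapping.keys p \<Longrightarrow> Poly_Mapping.lookup m s \<le> mdeg s p"
  by (simp add: mdeg_def)

lemma mdeg_eq_0_iff: "mdeg s p = 0 \<longleftrightarrow> (\<forall>m\<in>Poly_Mapping.keys p. Poly_Mapping.lookup m s = 0)"
proof
  show "mdeg s p = 0 \<Longrightarrow> \<forall>m\<in>Poly_Mapping.keys p. Poly_Mapping.lookup m s = 0"
    using lookup_le_mdeg[of _ p s] by fastforce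
  assume *: "\<forall>m\<in>Poly_Mapping.keys p. Poly_Mapping.lookup m s = 0"
  have "mdeg s p \<in> insert 0 ((\<lambda>m. Poly_Mapping.lookup m s) ` Poly_Mapping.keys p)"
    unfolding mdeg_def by (rule Max_in) auto
  with * show "mdeg s p = 0" by auto
qed

lemma coefp_beyond: "mdeg s p < i \<Longrightarrow> coefp s i p = 0"
  using lookup_le_mdeg[of _ p s] by (fastforce simp: coefp_eq_0_iff)

lemma coefp_0_neq_0: "\<not> pvar s dvd p \<Longrightarrow> coefp s 0 p \<noteq> 0"
  by (metis coefp_eq_0_iff not_pvar_dvdD)

lemma coefp_mdeg_neq_0:
  fixes p :: "'n::{finite,linorder} mpoly"
  assumes "p \<noteq> 0"
  shows "coefp s (mdeg s p) p \<noteq> 0"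
proof -
  obtain m where "m \<in> Poly_Mapping.keys p" "deg_wt s m = deg.wdeg s p"
    using deg.wdeg_attained[OF assms] by blast
  then show ?thesis
    using deg_wdeg_eq_mdeg[OF assms, of s] by (auto simp: coefp_eq_0_iff deg_wt_def)
qed

lemma mdeg_coefp: "mdeg s (coefp s i p) = 0"
  by (simp add: mdeg_eq_0_iff keys_coefp_lookup_0)

lemma coefp_expansion: "p = (\<Sum>i\<le>mdeg s p. coefp s i p * pvar s ^ i)"
proof -
  have "coefp s i p * pvar s ^ i =
      (\<Sum>m\<in>{m \<in> Poly_Mapping.keys p. Poly_Mapping.lookup m s = i}.
        Poly_Mapping.single m (Poly_Mapping.lookup p m))" for i
    unfolding coefp_def pvar_power sum_distrib_right mult_single
    by (intro sum.cong refl) (simp add: monom_split)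
  then have "(\<Sum>i\<le>mdeg s p. coefp s i p * pvar s ^ i) =
      (\<Sum>i\<le>mdeg s p. \<Sum>m\<in>{m \<in> Poly_Mapping.keys p. Poly_Mapping.lookup m s = i}.
        Poly_Mapping.single m (Poly_Mapping.lookup p m))"
    by simp
  also have "\<dots> = (\<Sum>m\<in>Poly_Mapping.keys p. Poly_Mapping.single m (Poly_Mapping.lookup p m))"
    by (rule sum.group) (auto simp: lookup_le_mdeg)
  finally show ?thesis by (simp add: sum_single_keys)
qed

lemma expansion_coefp: "expansion s p (\<lambda>i. coefp s i p)"
  unfolding expansion_def using coefp_expansion by (auto simp: mdeg_coefp)

lemma poly_at_coefp_sum:
  "poly_at p v = (\<Sum>i\<le>mdeg s p. poly_at (coefp s i p) v * v s ^ i)"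
  by (subst coefp_expansion[of p s]) (simp add: poly_at_sum poly_at_mult poly_at_power poly_at_pvar)

text \<open>A coefficient does not see entry s of the tuple. Hence a cluster symmetric map may be
  replaced by \<open>X \<circ> \<sigma>\<close> in the coefficients taken along its exchanged
  component.\<close>

lemma poly_at_coefp_cong:
  assumes "\<And>k. k \<noteq> s \<Longrightarrow> v k = v' k"
  shows "poly_at (coefp s i p) v = poly_at (coefp s i p) v'"
  unfolding poly_at_def
proof (intro sum.cong refl arg_cong2[where f = times] prod.cong)
  fix m k assume "m \<in> Poly_Mapping.keys (coefp s i p)"
  then show "v k ^ Poly_Mapping.lookup m k = v' k ^ Poly_Mapping.lookup m k"
    using assms[of k] keys_coefp_lookup_0[of m s i p] by (cases "k = s") auto
qed

text \<open>For the weights belonging to x_k with k other than s, removing powers of x_s changes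
  nothing. The top weight of a polynomial is therefore the largest one among its coefficients along
  s, as the next two lemmas state.\<close>

lemma (in weight) w_split:
  assumes "w (Poly_Mapping.single s 1) = 0" "Poly_Mapping.lookup m s = i"
  shows "w (m - Poly_Mapping.single s i) = w m"
proof -
  have "w (Poly_Mapping.single s j) = 0" for j
  proof (induction j)
    case (Suc j)
    then show ?case
      using assms(1) w_add[of "Poly_Mapping.single s 1" "Poly_Mapping.single s j"]
      by (simp flip: single_add)
  qed (simp add: w_zero)
  then show ?thesis
    using w_add[of "m - Poly_Mapping.single s i" "Poly_Mapping.single s i"] monom_split[OF assms(2)] by simp
qed

lemma (in weight) wdeg_coefp_le:
  assumes "w (Poly_Mapping.single s 1) = 0" "coefp s i p \<noteq> 0"
  shows "wdeg (coefp s i p) \<le> wdeg p"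
  using assms(2)
proof (rule wdeg_le)
  fix m assume "m \<in> Poly_Mapping.keys (coefp s i p)"
  then obtain m' where m': "m' \<in> Poly_Mapping.keys p" "Poly_Mapping.lookup m' s = i"
      "m = m' - Poly_Mapping.single s i"
    by (auto simp: keys_coefp)
  then show "w m \<le> wdeg p" using w_split[OF assms(1) m'(2)] wdeg_ge[OF m'(1)] by simp
qed

lemma (in weight) wdeg_coefp_attained:
  assumes "w (Poly_Mapping.single s 1) = 0" "p \<noteq> 0"
  obtains i where "i \<le> mdeg s p" "coefp s i p \<noteq> 0" "wdeg (coefp s i p) = wdeg p"
proof -
  obtain m where m: "m \<in> Poly_Mapping.keys p" "w m = wdeg p"
    using wdeg_attained[OF assms(2)] by blast
  define i where "i = Poly_Mapping.lookup m s"
  have key: "m - Poly_Mapping.single s i \<in> Poly_Mapping.keys (coefp s i p)"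
    unfolding keys_coefp using m(1) i_def by blast
  then have nz: "coefp s i p \<noteq> 0" by auto
  have "wdeg p \<le> wdeg (coefp s i p)"
    using wdeg_ge[OF key] w_split[OF assms(1) i_def[symmetric]] m(2) by simp
  with wdeg_coefp_le[OF assms(1) nz] have "wdeg (coefp s i p) = wdeg p" by simp
  moreover have "i \<le> mdeg s p" using m(1) by (simp add: i_def lookup_le_mdeg)
  ultimately show ?thesis using that nz by blast
qed

section \<open>Rational functions not involving a variable\<close>

text \<open>The subfield of rational functions in the other variables. One representation free of
  x_s is required, since any fraction can be expanded by a factor that contains x_s.\<close>

definition free_of :: "'n::{finite,linorder} \<Rightarrow> 'n ratfun \<Rightarrow> bool" where
  "free_of s R \<longleftrightarrow> (\<exists>p q. q \<noteq> 0 \<and> R = Fract p q \<and>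
     (\<forall>m\<in>Poly_Mapping.keys p \<union> Poly_Mapping.keys q. Poly_Mapping.lookup m s = 0))"

lemma free_of_Fract:
  assumes "\<And>m. m \<in> Poly_Mapping.keys p \<Longrightarrow> Poly_Mapping.lookup m s = 0"
  shows "free_of s (Fract p 1)"
  unfolding free_of_def using assms by (intro exI[of _ p] exI[of _ 1]) auto

lemma keys_mult_lookup_0:
  assumes "m \<in> Poly_Mapping.keys (p * q)"
    and "\<And>m. m \<in> Poly_Mapping.keys p \<union> Poly_Mapping.keys q \<Longrightarrow> Poly_Mapping.lookup m s = (0::nat)"
  shows "Poly_Mapping.lookup m s = 0"
  using assms keys_mult[of p q] by (fastforce simp: lookup_add)

lemma free_of_mult:
  assumes "free_of s R" "free_of s S"
  shows "free_of s (R * S)"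
proof -
  obtain p q where R: "q \<noteq> 0" "R = Fract p q"
    "\<forall>m\<in>Poly_Mapping.keys p \<union> Poly_Mapping.keys q. Poly_Mapping.lookup m s = 0"
    using assms(1) unfolding free_of_def by blast
  obtain p' q' where S: "q' \<noteq> 0" "S = Fract p' q'"
    "\<forall>m\<in>Poly_Mapping.keys p' \<union> Poly_Mapping.keys q'. Poly_Mapping.lookup m s = 0"
    using assms(2) unfolding free_of_def by blast
  show ?thesis
    unfolding free_of_def
  proof (intro exI conjI ballI)
    show "q * q' \<noteq> 0" "R * S = Fract (p * p') (q * q')" using R S by auto
    fix m assume "m \<in> Poly_Mapping.keys (p * p') \<union> Poly_Mapping.keys (q * q')"
    then show "Poly_Mapping.lookup m s = 0"
      using R(3) S(3) by (auto elim!: keys_mult_lookup_0)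
  qed
qed

lemma free_of_add:
  assumes "free_of s R" "free_of s S"
  shows "free_of s (R + S)"
proof -
  obtain p q where R: "q \<noteq> 0" "R = Fract p q"
    "\<forall>m\<in>Poly_Mapping.keys p \<union> Poly_Mapping.keys q. Poly_Mapping.lookup m s = 0"
    using assms(1) unfolding free_of_def by blast
  obtain p' q' where S: "q' \<noteq> 0" "S = Fract p' q'"
    "\<forall>m\<in>Poly_Mapping.keys p' \<union> Poly_Mapping.keys q'. Poly_Mapping.lookup m s = 0"
    using assms(2) unfolding free_of_def by blast
  show ?thesis
    unfolding free_of_def
  proof (intro exI conjI ballI)
    show "q * q' \<noteq> 0" "R + S = Fract (p * q' + p' * q) (q * q')" using R S by auto
    fix m assume "m \<in> Poly_Mapping.keys (p * q' + p' * q) \<union> Poly_Mapping.keys (q * q')"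
    then have "m \<in> Poly_Mapping.keys (p * q') \<or> m \<in> Poly_Mapping.keys (p' * q) \<or> m \<in> Poly_Mapping.keys (q * q')"
      using subsetD[OF keys_add[of "p * q'" "p' * q"]] by auto
    then show "Poly_Mapping.lookup m s = 0"
      using R(3) S(3) by (auto elim!: keys_mult_lookup_0)
  qed
qed

lemma free_of_0: "free_of s 0"
  unfolding Zero_fract_def by (rule free_of_Fract) simp

lemma free_of_1: "free_of s 1"
  unfolding One_fract_def by (rule free_of_Fract) simp

lemma free_of_minus:
  fixes R :: "'a::{finite,linorder} ratfun"
  shows "free_of s R \<Longrightarrow> free_of s (- R)"
proof -
  assume R: "free_of s R"
  have "free_of s (Fract (- 1) 1)" by (rule free_of_Fract) simp
  moreover have "Fract (- 1) 1 = (- 1 :: 'a ratfun)" by (simp add: One_fract_def)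
  ultimately have "free_of s (- 1 * R)" using free_of_mult[OF _ R] by metis
  then show ?thesis by simp
qed

lemma free_of_diff: "free_of s R \<Longrightarrow> free_of s S \<Longrightarrow> free_of s (R - S)"
  using free_of_add[of s R "- S"] free_of_minus[of s S] by simp

lemma free_of_inverse:
  assumes "free_of s R"
  shows "free_of s (inverse R)"
proof (cases "R = 0")
  case False
  obtain p q where R: "q \<noteq> 0" "R = Fract p q"
    "\<forall>m\<in>Poly_Mapping.keys p \<union> Poly_Mapping.keys q. Poly_Mapping.lookup m s = 0"
    using assms(1) unfolding free_of_def by blast
  moreover have "p \<noteq> 0" using R False by (auto simp: fract_collapse)
  ultimately show ?thesis
    unfolding free_of_def by (intro exI[of _ q] exI[of _ p]) auto
qed (simp add: free_of_0)

lemma free_of_divide: "free_of s R \<Longrightarrow> free_of s S \<Longrightarrow> free_of s (R / S)"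
  by (simp add: divide_inverse free_of_mult free_of_inverse)

lemma free_of_power: "free_of s R \<Longrightarrow> free_of s (R ^ k)"
  by (induction k) (simp_all add: free_of_1 free_of_mult)

lemma free_of_powi: "free_of s R \<Longrightarrow> free_of s (R powi k)"
  by (simp add: power_int_def free_of_power free_of_inverse)

lemma free_of_prod: "(\<And>i. i \<in> I \<Longrightarrow> free_of s (f i)) \<Longrightarrow> free_of s (\<Prod>i\<in>I. f i)"
  by (induction I rule: infinite_finite_induct) (simp_all add: free_of_1 free_of_mult)

lemma free_of_X: "k \<noteq> s \<Longrightarrow> free_of s (X k)"
  unfolding X_def by (rule free_of_Fract) (simp add: pvar_def lookup_single)

lemma free_of_coefp: "free_of s (poly_at (coefp s i p) X)"
  unfolding poly_at_X by (rule free_of_Fract) (rule keys_coefp_lookup_0)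

lemma free_of_perm_coefp:
  assumes "bij \<sigma>"
  shows "free_of s (poly_at (coefp (inv \<sigma> s) i p) (X \<circ> \<sigma>))"
  unfolding poly_at_perm[OF assms]
  by (rule free_of_Fract) (auto simp: keys_perm_poly[OF assms] keys_coefp_lookup_0)

lemma deg_val_free_of:
  assumes "free_of s R" "R \<noteq> 0"
  shows "deg.val s R = 0"
proof -
  obtain p q where R: "q \<noteq> 0" "R = Fract p q"
    "\<forall>m\<in>Poly_Mapping.keys p \<union> Poly_Mapping.keys q. Poly_Mapping.lookup m s = 0"
    using assms(1) unfolding free_of_def by blast
  moreover have "p \<noteq> 0" using R assms(2) by (auto simp: fract_collapse)
  moreover have "mdeg s p = 0" "mdeg s q = 0" using R(3) by (simp_all add: mdeg_eq_0_iff)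
  ultimately show ?thesis by (simp add: deg.val_Fract deg_wdeg_eq_mdeg)
qed

text \<open>A nonzero c_k has degree 0 in x_s, so the nonzero terms have the pairwise different
  degrees k, and such a sum does not vanish.\<close>

lemma free_of_independent:
  assumes "finite K" "\<And>k. k \<in> K \<Longrightarrow> free_of s (c k)" "(\<Sum>k\<in>K. c k * X s powi k) = 0" "k \<in> K"
  shows "c k = 0"
proof (rule ccontr)
  assume "c k \<noteq> 0"
  let ?K = "{k \<in> K. c k \<noteq> 0}"
  have "deg.val s (c k * X s powi k) = k" if "k \<in> ?K" for k
    using that assms(2) by (simp add: deg.val_mult deg.val_powi deg_val_X deg_val_free_of)
  then have "inj_on (\<lambda>k. deg.val s (c k * X s powi k)) ?K"
    by (intro inj_onI) simp
  then have "(\<Sum>k\<in>?K. c k * X s powi k) \<noteq> 0"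
    by (intro deg.sum_neq_0_if_distinct_val) (use assms \<open>c k \<noteq> 0\<close> in auto)
  moreover have "(\<Sum>k\<in>?K. c k * X s powi k) = (\<Sum>k\<in>K. c k * X s powi k)"
    using assms(1) by (intro sum.mono_neutral_left) auto
  ultimately show False using assms(3) by simp
qed

text \<open>The power k of x_s occurs on the left at i = A - k and on the right at j = k + B, so i
  is matched with A - i + B. An index whose partner would be negative has coefficient 0; this is how
  the ranges of exponents get constrained.\<close>

lemma free_of_expansions_eq:
  assumes a: "\<And>i. free_of s (a i)" "\<And>i. i > N \<Longrightarrow> a i = 0"
    and b: "\<And>j. free_of s (b j)" "\<And>j. j > M \<Longrightarrow> b j = 0"
    and eq: "(\<Sum>i\<le>N. a i * X s powi (A - int i)) = (\<Sum>j\<le>M. b j * X s powi (int j - B))"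
  shows "\<And>i. A - int i + B \<ge> 0 \<Longrightarrow> a i = b (nat (A - int i + B))"
    and "\<And>i. A - int i + B < 0 \<Longrightarrow> a i = 0"
    and "\<And>j. A + B - int j < 0 \<Longrightarrow> b j = 0"
proof -
  \<comment> \<open>Both sides are rewritten as sums over the union K of their exponents, with
    coefficients indexed by the exponent itself.\<close>
  define K where "K = (\<lambda>i. A - int i) ` {..N} \<union> (\<lambda>j. int j - B) ` {..M}"
  define a' where "a' = (\<lambda>k. if A - k \<ge> 0 then a (nat (A - k)) else 0)"
  define b' where "b' = (\<lambda>k. if k + B \<ge> 0 then b (nat (k + B)) else 0)"
  have fin: "finite K" by (simp add: K_def)
  have "(\<Sum>i\<le>N. a i * X s powi (A - int i)) = (\<Sum>k\<in>(\<lambda>i. A - int i) ` {..N}. a' k * X s powi k)"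
    by (subst sum.reindex) (auto simp: a'_def inj_on_def)
  also have "\<dots> = (\<Sum>k\<in>K. a' k * X s powi k)"
  proof (rule sum.mono_neutral_left[OF fin])
    show "\<forall>k\<in>K - (\<lambda>i. A - int i) ` {..N}. a' k * X s powi k = 0"
    proof
      fix k assume "k \<in> K - (\<lambda>i. A - int i) ` {..N}"
      then have "A - k \<ge> 0 \<Longrightarrow> nat (A - k) > N"
        by (auto simp: image_iff dest: bspec[of _ _ "nat (A - k)"])
      then show "a' k * X s powi k = 0" by (auto simp: a'_def a(2))
    qed
  qed (auto simp: K_def)
  finally have 1: "(\<Sum>i\<le>N. a i * X s powi (A - int i)) = (\<Sum>k\<in>K. a' k * X s powi k)" .
  have "(\<Sum>j\<le>M. b j * X s powi (int j - B)) = (\<Sum>k\<in>(\<lambda>j. int j - B) ` {..M}. b' k * X s powi k)"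
    by (subst sum.reindex) (auto simp: b'_def inj_on_def)
  also have "\<dots> = (\<Sum>k\<in>K. b' k * X s powi k)"
  proof (rule sum.mono_neutral_left[OF fin])
    show "\<forall>k\<in>K - (\<lambda>j. int j - B) ` {..M}. b' k * X s powi k = 0"
    proof
      fix k assume "k \<in> K - (\<lambda>j. int j - B) ` {..M}"
      then have "k + B \<ge> 0 \<Longrightarrow> nat (k + B) > M"
        by (auto simp: image_iff dest: bspec[of _ _ "nat (k + B)"])
      then show "b' k * X s powi k = 0" by (auto simp: b'_def b(2))
    qed
  qed (auto simp: K_def)
  finally have "(\<Sum>k\<in>K. (a' k - b' k) * X s powi k) = 0"
    using 1 eq by (simp add: left_diff_distrib sum_subtractf)
  then have "a' k - b' k = 0" if "k \<in> K" for k
    using that by (intro free_of_independent[OF fin, where c = "\<lambda>k. a' k - b' k"])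
      (auto simp: a'_def b'_def a b intro!: free_of_diff free_of_0 free_of_minus)
  moreover have "a' k = 0 \<and> b' k = 0" if "k \<notin> K" for k
  proof -
    have "A - k \<ge> 0 \<Longrightarrow> nat (A - k) > N"
      using that by (auto simp: K_def image_iff dest: bspec[of _ _ "nat (A - k)"])
    moreover have "k + B \<ge> 0 \<Longrightarrow> nat (k + B) > M"
      using that by (auto simp: K_def image_iff dest: bspec[of _ _ "nat (k + B)"])
    ultimately show ?thesis by (auto simp: a'_def b'_def a(2) b(2))
  qed
  ultimately have ab: "a' k = b' k" for k by (metis eq_iff_diff_eq_0)
  show "a i = b (nat (A - int i + B))" if "A - int i + B \<ge> 0" for i
    using ab[of "A - int i"] that by (simp add: a'_def b'_def)
  show "a i = 0" if "A - int i + B < 0" for i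
    using ab[of "A - int i"] that by (simp add: a'_def b'_def)
  show "b j = 0" if "A + B - int j < 0" for j
    using ab[of "int j - B"] that by (simp add: a'_def b'_def)
qed

text \<open>The differences of two expansions are coefficients of a vanishing sum of powers of x_s,
  so independence applies. Whatever expansions the routine picks, they are thus the canonical ones
  up to the degree.\<close>

lemma expansion_unique:
  assumes "expansion s p f" "i \<le> mdeg s p"
  shows "f i = coefp s i p"
proof -
  let ?c = "\<lambda>k. Fract (f (nat k) - coefp s (nat k) p) 1"
  have f: "p = (\<Sum>i\<le>mdeg s p. f i * pvar s ^ i)" "\<And>i. i \<le> mdeg s p \<Longrightarrow> mdeg s (f i) = 0"
    using assms(1) by (auto simp: expansion_def)
  have "(\<Sum>i\<le>mdeg s p. (f i - coefp s i p) * pvar s ^ i) = 0"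
    using f(1) coefp_expansion[of p s] by (simp add: left_diff_distrib sum_subtractf)
  then have "0 = poly_at (\<Sum>i\<le>mdeg s p. (f i - coefp s i p) * pvar s ^ i) X" by simp
  also have "\<dots> = (\<Sum>i\<le>mdeg s p. ?c (int i) * X s powi int i)"
    unfolding poly_at_sum poly_at_mult poly_at_power poly_at_pvar
    by (simp add: poly_at_X)
  also have "\<dots> = (\<Sum>k\<in>int ` {..mdeg s p}. ?c k * X s powi k)"
    by (subst sum.reindex) auto
  finally have sum: "(\<Sum>k\<in>int ` {..mdeg s p}. ?c k * X s powi k) = 0" by simp
  have "?c (int i) = 0"
  proof (rule free_of_independent[OF _ _ sum])
    fix k assume "k \<in> int ` {..mdeg s p}"
    then have "mdeg s (f (nat k)) = 0" using f(2) by auto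
    then have "free_of s (Fract (f (nat k)) 1)"
      by (intro free_of_Fract) (simp add: mdeg_eq_0_iff)
    then have "free_of s (Fract (f (nat k)) 1 - Fract (coefp s (nat k) p) 1)"
      using free_of_coefp[of s "nat k" p] by (intro free_of_diff) (simp_all add: poly_at_X)
    then show "free_of s (?c k)" by simp
  qed (use assms(2) in auto)
  then show ?thesis by (simp add: Fract_1_eq_0_iff)
qed

section \<open>Exchange polynomials\<close>

text \<open>For i \<le> r the integer exponent is i |b_k| or (r - i) |b_k|, according to the sign of
  b_k, so \<open>nat\<close> truncates nothing.\<close>

definition exch_monom :: "('n::finite \<Rightarrow> int) \<Rightarrow> nat \<Rightarrow> nat \<Rightarrow> ('n \<Rightarrow>\<^sub>0 nat)" where
  "exch_monom b r i = Abs_poly_mapping (\<lambda>k. nat (int r * max (- b k) 0 + int i * b k))"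

definition exch_mpoly :: "('n::finite \<Rightarrow> int) \<Rightarrow> nat \<Rightarrow> nat poly \<Rightarrow> 'n mpoly" where
  "exch_mpoly b r Z = (\<Sum>i\<le>r. Poly_Mapping.single (exch_monom b r i) (of_nat (coeff Z i)))"

lemma lookup_exch_monom:
  assumes "i \<le> r"
  shows "int (Poly_Mapping.lookup (exch_monom b r i) k) = int r * max (- b k) 0 + int i * b k"
proof -
  have "0 \<le> int r * max (- b k) 0 + int i * b k"
  proof (cases "b k \<ge> 0")
    case False
    then have "int i * (- b k) \<le> int r * (- b k)" using assms by (intro mult_right_mono) auto
    then show ?thesis using False by (simp add: max_def)
  qed (simp add: max_def)
  then show ?thesis by (simp add: exch_monom_def)
qed

lemma poly_sum_atMost:
  fixes x :: "'a::comm_semiring_1"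
  assumes "degree p \<le> r"
  shows "poly p x = (\<Sum>i\<le>r. coeff p i * x ^ i)"
  unfolding poly_altdef using assms
  by (intro sum.mono_neutral_left) (auto simp: coeff_eq_0)

lemma exchange_poly_eq:
  assumes "degree Z \<le> r"
  shows "exchange_poly (b, r, Z) = Fract (exch_mpoly b r Z) 1"
proof -
  let ?v = "monom_at X (\<lambda>i. int r * max (- b i) 0)"
  have deg: "degree (map_poly of_nat Z :: 'a ratfun poly) \<le> r"
    using assms by (intro degree_le) (auto simp: coeff_map_poly coeff_eq_0)
  have "?v * monom_at X b ^ i = monom_pow X (exch_monom b r i)" if "i \<le> r" for i
  proof -
    have "monom_at X b ^ i = monom_at X (\<lambda>k. int i * b k)"
      unfolding monom_at_def prod_power_distrib
      by (intro prod.cong refl) (simp only: mult.commute[of "int i"] power_int_mult power_int_of_nat)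
    then have "?v * monom_at X b ^ i = monom_at X (\<lambda>k. int r * max (- b k) 0 + int i * b k)"
      by (simp add: monom_at_add)
    also have "\<dots> = monom_pow X (exch_monom b r i)"
      unfolding monom_at_def monom_pow_def
      by (intro prod.cong refl) (simp flip: lookup_exch_monom[OF that])
    finally show ?thesis .
  qed
  then have "exchange_poly (b, r, Z) =
      (\<Sum>i\<le>r. ratconst (of_nat (coeff Z i)) * monom_pow X (exch_monom b r i))"
    by (simp add: exchange_poly_def poly_sum_atMost[OF deg] sum_distrib_left mult.left_commute
        coeff_map_poly ratconst_of_nat)
  then show ?thesis
    by (simp add: monom_pow_X ratconst_mult_Fract_single Fract_sum exch_mpoly_def)
qed

lemma lookup_exch_mpoly_nonneg: "0 \<le> Poly_Mapping.lookup (exch_mpoly b r Z) m"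
  by (auto simp: exch_mpoly_def lookup_sum_single when_def intro!: sum_nonneg)

text \<open>Different i can give the same monomial (all of them do for b = 0), but the coefficients
  are nonnegative, so a positive one is never cancelled.\<close>

lemma exch_monom_in_keys:
  assumes "i \<le> r" "coeff Z i > 0"
  shows "exch_monom b r i \<in> Poly_Mapping.keys (exch_mpoly b r Z)"
proof -
  have "0 < (\<Sum>j\<le>r. ((of_nat (coeff Z j) :: rat) when exch_monom b r j = exch_monom b r i))"
    by (rule sum_pos2[of _ i]) (use assms in \<open>auto simp: when_def\<close>)
  then show ?thesis
    by (simp add: in_keys_iff exch_mpoly_def lookup_sum_single)
qed

lemma keys_exch_mpoly_subset: "Poly_Mapping.keys (exch_mpoly b r Z) \<subseteq> exch_monom b r ` {..r}"
  unfolding exch_mpoly_def by (rule keys_sum_single_subset)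

lemma exch_mpoly_neq_0:
  assumes "is_seedlet s (b, r, Z)"
  shows "exch_mpoly b r Z \<noteq> 0"
  using exch_monom_in_keys[of 0 r Z b] assms by (auto simp: is_seedlet_def)

lemma exchange_poly_neq_0: "is_seedlet s \<omega> \<Longrightarrow> exchange_poly \<omega> \<noteq> 0"
  by (cases \<omega>) (auto simp: exchange_poly_eq exch_mpoly_neq_0 Fract_1_eq_0_iff is_seedlet_def
      dest: exch_mpoly_neq_0)

lemma free_of_exchange_poly:
  assumes "is_seedlet s \<omega>"
  shows "free_of s (exchange_poly \<omega>)"
proof -
  obtain b r Z where \<omega>: "\<omega> = (b, r, Z)" by (cases \<omega>)
  have "free_of s (Fract (exch_mpoly b r Z) 1)"
  proof (rule free_of_Fract)
    fix m assume "m \<in> Poly_Mapping.keys (exch_mpoly b r Z)"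
    then obtain i where "i \<le> r" "m = exch_monom b r i"
      using keys_exch_mpoly_subset by blast
    then show "Poly_Mapping.lookup m s = 0"
      using assms lookup_exch_monom[of i r b s] by (simp add: \<omega> is_seedlet_def)
  qed
  then show ?thesis using assms by (simp add: \<omega> exchange_poly_eq is_seedlet_def)
qed

text \<open>The extreme exponents of \<open>x\<^sub>k\<close> in an exchange polynomial belong to \<open>z\<^sub>0\<close> and \<open>z\<^sub>r\<close>.\<close>

lemma deg_val_exchange_poly:
  assumes "is_seedlet s (b, r, Z)"
  shows "deg.val k (exchange_poly (b, r, Z)) = int r * \<bar>b k\<bar>"
proof -
  have seed: "degree Z \<le> r" "coeff Z 0 > 0" "coeff Z r > 0"
    using assms by (auto simp: is_seedlet_def)
  have nz: "exch_mpoly b r Z \<noteq> 0" by (rule exch_mpoly_neq_0[OF assms])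
  have "deg.wdeg k (exch_mpoly b r Z) = int r * \<bar>b k\<bar>"
  proof (rule antisym)
    show "deg.wdeg k (exch_mpoly b r Z) \<le> int r * \<bar>b k\<bar>"
    proof (rule deg.wdeg_le[OF nz])
      fix m assume "m \<in> Poly_Mapping.keys (exch_mpoly b r Z)"
      then obtain i where i: "i \<le> r" "m = exch_monom b r i"
        using keys_exch_mpoly_subset by blast
      have "int i * \<bar>b k\<bar> \<le> int r * \<bar>b k\<bar>" using i(1) by (intro mult_right_mono) auto
      then show "deg_wt k m \<le> int r * \<bar>b k\<bar>"
        using i by (auto simp: deg_wt_def lookup_exch_monom max_def abs_if mult_nonneg_nonpos)
    qed
    have "deg_wt k (exch_monom b r 0) \<le> deg.wdeg k (exch_mpoly b r Z)"
      "deg_wt k (exch_monom b r r) \<le> deg.wdeg k (exch_mpoly b r Z)"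
      using seed by (auto intro!: deg.wdeg_ge exch_monom_in_keys)
    then show "int r * \<bar>b k\<bar> \<le> deg.wdeg k (exch_mpoly b r Z)"
      by (auto simp: deg_wt_def lookup_exch_monom max_def abs_if split: if_splits)
  qed
  then show ?thesis using seed(1) nz by (simp add: exchange_poly_eq deg.val_Fract deg.wdeg_one)
qed

text \<open>One of the two end monomials avoids x_k: i = 0 if b_k \<ge> 0, and i = r
  otherwise.\<close>

lemma ord_val_exchange_poly:
  assumes "is_seedlet s \<omega>"
  shows "ord.val k (exchange_poly \<omega>) = 0"
proof -
  obtain b r Z where \<omega>: "\<omega> = (b, r, Z)" by (cases \<omega>)
  have seed: "degree Z \<le> r" "coeff Z 0 > 0" "coeff Z r > 0"
    using assms by (auto simp: \<omega> is_seedlet_def)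
  have nz: "exch_mpoly b r Z \<noteq> 0" using assms \<omega> exch_mpoly_neq_0 by blast
  have "exch_monom b r 0 \<in> Poly_Mapping.keys (exch_mpoly b r Z)"
    "exch_monom b r r \<in> Poly_Mapping.keys (exch_mpoly b r Z)"
    using seed by (auto intro!: exch_monom_in_keys)
  moreover have "Poly_Mapping.lookup (exch_monom b r 0) k = 0 \<or> Poly_Mapping.lookup (exch_monom b r r) k = 0"
    by (cases "b k \<ge> 0") (auto simp: exch_monom_def max_def)
  ultimately have "\<not> pvar k dvd exch_mpoly b r Z"
    using not_pvar_dvdI by blast
  then show ?thesis
    using seed nz by (simp add: \<omega> exchange_poly_eq ord.val_Fract ord.wdeg_one ord_wdeg_eq_0)
qed

section \<open>Positive rational functions and uniqueness of roots\<close>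

lemma lead_coef_neq_0: "p \<noteq> 0 \<Longrightarrow> lead_coef p \<noteq> 0"
  using Max_in[of "Poly_Mapping.keys p"] by (simp add: lead_coef_def in_keys_iff)

lemma lead_coef_uminus: "lead_coef (- p) = - lead_coef p"
  by (simp add: lead_coef_def)

lemma lead_coef_eqI:
  assumes "M \<in> Poly_Mapping.keys p" "\<And>m. m \<in> Poly_Mapping.keys p \<Longrightarrow> m \<le> M"
  shows "lead_coef p = Poly_Mapping.lookup p M"
  unfolding lead_coef_def using assms by (subst Max_eqI) auto

text \<open>By strict monotonicity of addition of exponents, the sum of the two largest monomials
  arises from no other pair.\<close>

lemma lead_coef_mult:
  fixes p q :: "'n::{finite,linorder} mpoly"
  assumes "p \<noteq> 0" "q \<noteq> 0"
  shows "lead_coef (p * q) = lead_coef p * lead_coef q"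
proof -
  define A where "A = Max (Poly_Mapping.keys p)"
  define B where "B = Max (Poly_Mapping.keys q)"
  have A: "A \<in> Poly_Mapping.keys p" "\<And>m. m \<in> Poly_Mapping.keys p \<Longrightarrow> m \<le> A"
    unfolding A_def using assms(1) by (auto intro: Max_in)
  have B: "B \<in> Poly_Mapping.keys q" "\<And>m. m \<in> Poly_Mapping.keys q \<Longrightarrow> m \<le> B"
    unfolding B_def using assms(2) by (auto intro: Max_in)
  have lookup: "Poly_Mapping.lookup (p * q) (A + B) = Poly_Mapping.lookup p A * Poly_Mapping.lookup q B"
  proof (rule lookup_mult_unique[OF A(1) B(1)])
    fix a b assume ab: "a \<in> Poly_Mapping.keys p" "b \<in> Poly_Mapping.keys q" "a + b = A + B"
    have le: "a \<le> A" "b \<le> B" using ab A(2) B(2) by auto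
    show "a = A \<and> b = B"
    proof (rule ccontr)
      assume "\<not> (a = A \<and> b = B)"
      with le have "a < A \<or> b < B" by auto
      with le have "a + b < A + B"
        by (auto intro: add_less_le_mono add_le_less_mono)
      with ab(3) show False by simp
    qed
  qed
  have "lead_coef (p * q) = Poly_Mapping.lookup (p * q) (A + B)"
  proof (rule lead_coef_eqI)
    show "A + B \<in> Poly_Mapping.keys (p * q)"
      using lookup A(1) B(1) by (simp add: in_keys_iff)
    fix m assume "m \<in> Poly_Mapping.keys (p * q)"
    then obtain a b where "m = a + b" "a \<in> Poly_Mapping.keys p" "b \<in> Poly_Mapping.keys q"
      using keys_mult[of p q] by auto
    then show "m \<le> A + B" using A(2) B(2) by (auto intro: add_mono)
  qed
  with lookup show ?thesis by (simp add: lead_coef_def A_def B_def)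
qed

text \<open>If the leading monomials differ, the larger one survives; if they agree, two positive
  coefficients are added.\<close>

lemma lead_coef_add_pos:
  assumes "lead_coef p > 0" "lead_coef q > 0" "p \<noteq> 0" "q \<noteq> 0"
  shows "lead_coef (p + q) > 0"
proof -
  define A where "A = Max (Poly_Mapping.keys p)"
  define B where "B = Max (Poly_Mapping.keys q)"
  define M where "M = max A B"
  have A: "A \<in> Poly_Mapping.keys p" "\<And>m. m \<in> Poly_Mapping.keys p \<Longrightarrow> m \<le> A"
    unfolding A_def using assms by (auto intro: Max_in)
  have B: "B \<in> Poly_Mapping.keys q" "\<And>m. m \<in> Poly_Mapping.keys q \<Longrightarrow> m \<le> B"
    unfolding B_def using assms by (auto intro: Max_in)
  have pos: "Poly_Mapping.lookup p A > 0" "Poly_Mapping.lookup q B > 0"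
    using assms by (auto simp: lead_coef_def A_def B_def)
  have z: "Poly_Mapping.lookup p m = 0" if "A < m" for m
    using A(2)[of m] that by (meson in_keys_iff leD)
  have z': "Poly_Mapping.lookup q m = 0" if "B < m" for m
    using B(2)[of m] that by (meson in_keys_iff leD)
  have "A < B \<or> A = B \<or> B < A" by auto
  then have M: "Poly_Mapping.lookup (p + q) M > 0"
    using pos z z' by (auto simp: M_def lookup_add max_def)
  have "lead_coef (p + q) = Poly_Mapping.lookup (p + q) M"
  proof (rule lead_coef_eqI)
    show "M \<in> Poly_Mapping.keys (p + q)" using M by (simp add: in_keys_iff)
    fix m assume "m \<in> Poly_Mapping.keys (p + q)"
    then have "m \<in> Poly_Mapping.keys p \<or> m \<in> Poly_Mapping.keys q"
      using subsetD[OF keys_add[of p q]] by auto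
    then show "m \<le> M" using A(2) B(2) by (auto simp: M_def le_max_iff_disj)
  qed
  with M show ?thesis by simp
qed

lemma ratfun_posE:
  assumes "ratfun_pos P"
  obtains p q where "p \<noteq> 0" "q \<noteq> 0" "P = Fract p q" "lead_coef p > 0" "lead_coef q > 0"
  using assms unfolding ratfun_pos_def by blast

lemma ratfun_pos_mult:
  assumes "ratfun_pos P" "ratfun_pos Q"
  shows "ratfun_pos (P * Q)"
proof -
  obtain p q where P: "p \<noteq> 0" "q \<noteq> 0" "P = Fract p q" "lead_coef p > 0" "lead_coef q > 0"
    using ratfun_posE[OF assms(1)] .
  obtain p' q' where Q: "p' \<noteq> 0" "q' \<noteq> 0" "Q = Fract p' q'" "lead_coef p' > 0" "lead_coef q' > 0"
    using ratfun_posE[OF assms(2)] .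
  show ?thesis
    unfolding ratfun_pos_def
    by (intro exI[of _ "p * p'"] exI[of _ "q * q'"]) (use P Q in \<open>simp add: lead_coef_mult\<close>)
qed

lemma ratfun_pos_add:
  assumes "ratfun_pos P" "ratfun_pos Q"
  shows "ratfun_pos (P + Q)"
proof -
  obtain p q where P: "p \<noteq> 0" "q \<noteq> 0" "P = Fract p q" "lead_coef p > 0" "lead_coef q > 0"
    using ratfun_posE[OF assms(1)] .
  obtain p' q' where Q: "p' \<noteq> 0" "q' \<noteq> 0" "Q = Fract p' q'" "lead_coef p' > 0" "lead_coef q' > 0"
    using ratfun_posE[OF assms(2)] .
  have pos: "lead_coef (p * q' + p' * q) > 0"
    by (rule lead_coef_add_pos) (use P Q in \<open>simp_all add: lead_coef_mult\<close>)
  moreover from pos have "p * q' + p' * q \<noteq> 0" by (auto simp: lead_coef_def)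
  ultimately show ?thesis
    unfolding ratfun_pos_def
    by (intro exI[of _ "p * q' + p' * q"] exI[of _ "q * q'"]) (use P Q in \<open>simp add: lead_coef_mult\<close>)
qed

lemma not_ratfun_pos_0: "\<not> ratfun_pos 0"
  by (auto simp: ratfun_pos_def Zero_fract_def eq_fract)

lemma ratfun_pos_1: "ratfun_pos 1"
  unfolding ratfun_pos_def One_fract_def
  by (intro exI[of _ 1]) (simp add: lead_coef_def)

text \<open>The sign of the denominator can be normalized by changing both signs; the numerator then
  decides.\<close>

lemma ratfun_pos_cases:
  fixes P :: "'n::{finite,linorder} ratfun"
  assumes "P \<noteq> 0"
  shows "ratfun_pos P \<or> ratfun_pos (- P)"
proof -
  obtain p q where P: "P = Fract p q" "p \<noteq> 0" "q \<noteq> 0"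
    using assms by (cases P rule: Fract_cases_nonzero) auto
  have "\<exists>p q. P = Fract p q \<and> p \<noteq> 0 \<and> q \<noteq> 0 \<and> lead_coef q > 0"
  proof (cases "lead_coef q > 0")
    case False
    then have "lead_coef (- q) > 0"
      using lead_coef_neq_0[OF P(3)] by (simp add: lead_coef_uminus)
    then show ?thesis using P by (intro exI[of _ "- p"] exI[of _ "- q"]) simp
  qed (use P in blast)
  then obtain p q where P: "P = Fract p q" "p \<noteq> 0" "q \<noteq> 0" "lead_coef q > 0" by blast
  show ?thesis
  proof (cases "lead_coef p > 0")
    case True
    with P show ?thesis unfolding ratfun_pos_def by blast
  next
    case False
    then have "lead_coef (- p) > 0"
      using lead_coef_neq_0[OF P(2)] by (simp add: lead_coef_uminus)
    then have "ratfun_pos (- P)"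
      unfolding ratfun_pos_def using P by (intro exI[of _ "- p"] exI[of _ q]) simp
    then show ?thesis ..
  qed
qed

lemma ratfun_pos_power: "ratfun_pos P \<Longrightarrow> ratfun_pos (P ^ k)"
  by (induction k) (simp_all add: ratfun_pos_1 ratfun_pos_mult)

lemma ratfun_pos_sum:
  assumes "finite I" "I \<noteq> {}" "\<And>i. i \<in> I \<Longrightarrow> ratfun_pos (f i)"
  shows "ratfun_pos (\<Sum>i\<in>I. f i)"
  using assms by (induction I rule: finite_ne_induct) (auto simp: ratfun_pos_add)

text \<open>P^m - Q^m is P - Q times a sum of products of positive elements. That sum is positive,
  hence nonzero.\<close>

lemma ratfun_pos_root_unique:
  assumes "ratfun_pos P" "ratfun_pos Q" "P ^ m = Q ^ m" "m > 0"
  shows "P = Q"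
proof -
  obtain k where k: "m = Suc k" using assms(4) by (cases m) auto
  have "(P - Q) * (\<Sum>p<Suc k. P ^ p * Q ^ (k - p)) = P ^ Suc k - Q ^ Suc k"
    using power_diff_sumr2[of P "Suc k" Q] by (simp add: mult.commute)
  then have "(P - Q) * (\<Sum>p<Suc k. P ^ p * Q ^ (k - p)) = 0"
    using assms(3) k by simp
  moreover have "ratfun_pos (\<Sum>p<Suc k. P ^ p * Q ^ (k - p))"
    using assms by (intro ratfun_pos_sum) (auto intro: ratfun_pos_mult ratfun_pos_power)
  then have "(\<Sum>p<Suc k. P ^ p * Q ^ (k - p)) \<noteq> 0"
    using not_ratfun_pos_0 by metis
  ultimately show ?thesis by simp
qed

text \<open>For odd m the definition of \<open>is_root\<close> does not ask for positivity, but it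
  is forced: if -P were positive, so would be -(Q^m), whereas Q^m is positive.\<close>

lemma is_root_unique:
  assumes "is_root m R P" "ratfun_pos Q" "Q ^ m = R" "m > 0"
  shows "P = Q"
proof -
  have eq: "P ^ m = Q ^ m" using assms by (simp add: is_root_def)
  have "ratfun_pos P"
  proof (cases "even m")
    case True
    then show ?thesis using assms(1) by (simp add: is_root_def)
  next
    case False
    have "Q ^ m \<noteq> 0" using assms(2) not_ratfun_pos_0 by auto
    with eq have "P ^ m \<noteq> 0" by simp
    with assms(4) have "P \<noteq> 0" by (metis power_eq_0_iff)
    moreover have "\<not> ratfun_pos (- P)"
    proof
      assume "ratfun_pos (- P)"
      then have "ratfun_pos ((- P) ^ m)" by (rule ratfun_pos_power)
      also have "(- P) ^ m = - (Q ^ m)" using False eq by simp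
      finally have "ratfun_pos (- (Q ^ m) + Q ^ m)"
        using ratfun_pos_power[OF assms(2)] by (rule ratfun_pos_add)
      then show False by (simp add: not_ratfun_pos_0)
    qed
    ultimately show ?thesis using ratfun_pos_cases by blast
  qed
  then show ?thesis by (rule ratfun_pos_root_unique[OF _ assms(2) eq assms(4)])
qed

lemma ratfun_pos_exchange_poly:
  assumes "is_seedlet s \<omega>"
  shows "ratfun_pos (exchange_poly \<omega>)"
proof -
  obtain b r Z where \<omega>: "\<omega> = (b, r, Z)" by (cases \<omega>)
  have nz: "exch_mpoly b r Z \<noteq> 0" using assms \<omega> exch_mpoly_neq_0 by blast
  have "lead_coef (exch_mpoly b r Z) \<ge> 0"
    by (simp add: lead_coef_def lookup_exch_mpoly_nonneg)
  with lead_coef_neq_0[OF nz] have "lead_coef (exch_mpoly b r Z) > 0" by simp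
  with nz have "ratfun_pos (Fract (exch_mpoly b r Z) 1)"
    unfolding ratfun_pos_def
    by (intro exI[of _ "exch_mpoly b r Z"] exI[of _ 1]) (simp add: lead_coef_def[of 1])
  then show ?thesis using assms by (simp add: \<omega> exchange_poly_eq is_seedlet_def)
qed

section \<open>Characterization of cluster symmetric pairs\<close>

lemma deg_val_perm:
  assumes "bij \<sigma>" "p \<noteq> 0"
  shows "deg.val k (poly_at p (X \<circ> \<sigma>)) = deg.wdeg (inv \<sigma> k) p"
  using assms
  by (simp add: poly_at_perm deg.val_Fract perm_poly_eq_0_iff deg.wdeg_one)
    (simp add: deg.wdeg_def keys_perm_poly image_image deg_wt_def)

lemma ord_val_perm:
  assumes "bij \<sigma>" "p \<noteq> 0"
  shows "ord.val k (poly_at p (X \<circ> \<sigma>)) = ord.wdeg (inv \<sigma> k) p"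
  using assms
  by (simp add: poly_at_perm ord.val_Fract perm_poly_eq_0_iff ord.wdeg_one)
    (simp add: ord.wdeg_def keys_perm_poly image_image ord_wt_def)

lemma deg_val_poly_at_X: "p \<noteq> 0 \<Longrightarrow> deg.val k (poly_at p X) = deg.wdeg k p"
  by (simp add: poly_at_X deg.val_Fract deg.wdeg_one)

lemma ord_val_poly_at_X: "p \<noteq> 0 \<Longrightarrow> ord.val k (poly_at p X) = ord.wdeg k p"
  by (simp add: poly_at_X ord.val_Fract ord.wdeg_one)

lemma ord_wdeg_nonpos: "p \<noteq> 0 \<Longrightarrow> ord.wdeg k p \<le> 0"
  by (rule ord.wdeg_le) (simp_all add: ord_wt_def)

lemma deg_wdeg_nonneg: "p \<noteq> 0 \<Longrightarrow> deg.wdeg k p \<ge> 0"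
  by (simp add: deg_wdeg_eq_mdeg)

lemma wt_single_neq:
  assumes "k \<noteq> s"
  shows "deg_wt k (Poly_Mapping.single s 1) = 0" "ord_wt k (Poly_Mapping.single s 1) = 0"
  using assms by (simp_all add: deg_wt_def ord_wt_def lookup_single when_def)

text \<open>The test of the routine with d_s + d'_s replaced by half of the degree, so that d' no
  longer occurs. The natural-number division is exact wherever the degree in x_s is even, as it is
  for every cluster symmetric pair.\<close>

definition coefs_match ::
    "'n::{finite,linorder} mpoly \<Rightarrow> 'n \<Rightarrow> ('n \<Rightarrow> 'n) \<Rightarrow> 'n ratfun \<Rightarrow> bool" where
  "coefs_match T s \<sigma> P \<longleftrightarrow> (\<forall>i\<le>mdeg s T. poly_at (coefp (inv \<sigma> s) i T) (X \<circ> \<sigma>) =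
     poly_at (coefp s (mdeg s T - i) T) X * P powi (int (mdeg s T div 2) - int i))"

lemma cs_map_neq_0:
  assumes "is_seedlet s \<omega>"
  shows "cs_map \<sigma> s \<omega> i \<noteq> 0"
  using exchange_poly_neq_0[OF assms] by (simp add: cs_map_def)

lemma laurent_at_shifted:
  assumes "type_rep F T d" "\<And>i. v i \<noteq> 0"
  shows "laurent_at (laurent_monom (\<lambda>i. - d' i) * F) v = poly_at T v / monom_at v (\<lambda>i. d i + d' i)"
  unfolding laurent_at_monom_mult[of v, OF assms(2)] laurent_at_type_rep[OF assms]
    monom_at_uminus monom_at_add[of v, OF assms(2)]
  by (simp add: divide_inverse)

text \<open>The map sends x_t to P / x_s and permutes the rest, so expanding T along t makes x_s
  appear only through P / x_s. \<open>M1\<close> and \<open>M2\<close> collect the parts of the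
  denominators without x_s; every bracketed coefficient is free of x_s.\<close>

lemma is_cs_pair_iff_expansions:
  fixes d d' D :: "'n::{finite,linorder} \<Rightarrow> int"
  assumes "bij \<sigma>" "is_seedlet s \<omega>" "type_rep F T d"
  defines "D \<equiv> \<lambda>i. d i + d' i"
    and "P \<equiv> exchange_poly \<omega>"
    and "t \<equiv> inv \<sigma> s"
    and "M1 \<equiv> (\<Prod>k\<in>UNIV - {s}. X k powi D (inv \<sigma> k))"
    and "M2 \<equiv> (\<Prod>k\<in>UNIV - {s}. X k powi D k)"
  shows "is_cs_pair F \<sigma> s \<omega> d' \<longleftrightarrow>
    (\<Sum>i\<le>mdeg t T. (poly_at (coefp t i T) (X \<circ> \<sigma>) * P powi (int i - D t) / M1) * X s powi (D t - int i)) =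
    (\<Sum>j\<le>mdeg s T. (poly_at (coefp s j T) X / M2) * X s powi (int j - D s))"
proof -
  define \<psi> where "\<psi> = cs_map \<sigma> s \<omega>"
  have \<psi>: "\<psi> i \<noteq> 0" for i by (simp add: \<psi>_def cs_map_neq_0[OF assms(2)])
  have P: "P \<noteq> 0" using exchange_poly_neq_0[OF assms(2)] by (simp add: P_def)
  have \<psi>_t: "\<psi> t = P / X s" by (simp add: \<psi>_def cs_map_def t_def P_def)
  have \<psi>_other: "\<psi> i = X (\<sigma> i)" if "i \<noteq> t" for i
    using that by (simp add: \<psi>_def cs_map_def t_def)
  have \<sigma>t: "\<sigma> t = s" using assms(1) by (simp add: t_def bij_inv_eq_iff[symmetric])
  have nz: "M1 \<noteq> 0" "M2 \<noteq> 0" by (simp_all add: M1_def M2_def)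
  have "monom_at \<psi> D = (\<Prod>i\<in>UNIV - {t}. \<psi> i powi D i) * (P / X s) powi D t"
    unfolding monom_at_def by (subst prod.remove[of _ t]) (auto simp: \<psi>_t)
  also have "(\<Prod>i\<in>UNIV - {t}. \<psi> i powi D i) = (\<Prod>i\<in>UNIV - {t}. X (\<sigma> i) powi D (inv \<sigma> (\<sigma> i)))"
    using assms(1) by (intro prod.cong refl) (simp add: \<psi>_other bij_is_inj)
  also have "\<dots> = M1"
    unfolding M1_def
  proof (rule prod.reindex_bij_betw)
    show "bij_betw \<sigma> (UNIV - {t}) (UNIV - {s})"
      using assms(1) \<sigma>t by (auto simp: bij_betw_def inj_on_def bij_def image_set_diff)
  qed
  finally have monom_\<psi>: "monom_at \<psi> D = M1 * (P / X s) powi D t" .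
  have monom_X: "monom_at X D = M2 * X s powi D s"
    unfolding monom_at_def M2_def by (subst prod.remove[of _ s]) (auto simp: mult.commute)
  have "poly_at (coefp t i T) \<psi> = poly_at (coefp t i T) (X \<circ> \<sigma>)" for i
    by (rule poly_at_coefp_cong) (simp add: \<psi>_other)
  then have "poly_at T \<psi> / monom_at \<psi> D =
      (\<Sum>i\<le>mdeg t T. poly_at (coefp t i T) (X \<circ> \<sigma>) * (P / X s) ^ i / (M1 * (P / X s) powi D t))"
    by (simp add: poly_at_coefp_sum[of T \<psi> t] monom_\<psi> \<psi>_t sum_divide_distrib)
  also have "\<dots> = (\<Sum>i\<le>mdeg t T.
      (poly_at (coefp t i T) (X \<circ> \<sigma>) * P powi (int i - D t) / M1) * X s powi (D t - int i))"
  proof (intro sum.cong refl)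
    fix i
    have "(P / X s) ^ i / (P / X s) powi D t = (P / X s) powi (int i - D t)"
      using P by (simp add: power_int_diff)
    also have "\<dots> = P powi (int i - D t) * X s powi (D t - int i)"
      using power_int_minus[of "X s" "int i - D t"]
      by (simp add: power_int_divide_distrib) (simp add: divide_inverse)
    finally have quot: "(P / X s) ^ i / (P / X s) powi D t = P powi (int i - D t) * X s powi (D t - int i)" .
    have "x * y / (M1 * z) = x * (y / z) / M1" for x y z :: "'n ratfun" by simp
    then show "poly_at (coefp t i T) (X \<circ> \<sigma>) * (P / X s) ^ i / (M1 * (P / X s) powi D t) =
        (poly_at (coefp t i T) (X \<circ> \<sigma>) * P powi (int i - D t) / M1) * X s powi (D t - int i)"
      by (simp only: quot mult.assoc times_divide_eq_left)
  qed
  finally have lhs: "poly_at T \<psi> / monom_at \<psi> D = \<dots>" .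
  have rhs: "poly_at T X / monom_at X D =
      (\<Sum>j\<le>mdeg s T. (poly_at (coefp s j T) X / M2) * X s powi (int j - D s))"
    using nz by (simp add: poly_at_coefp_sum[of T X s] monom_X sum_divide_distrib power_int_diff field_simps)
  show ?thesis
    using laurent_at_shifted[OF assms(3) \<psi>, of d'] laurent_at_shifted[OF assms(3), of X d'] lhs rhs
    by (simp add: is_cs_pair_def Let_def \<psi>_def[symmetric] D_def)
qed

lemma free_tuples_iff:
  "d' \<in> free_tuples T d s \<sigma> \<longleftrightarrow>
     (\<forall>i. d (\<sigma> i) + d' (\<sigma> i) = d i + d' i) \<and> 2 * (d s + d' s) = int (mdeg s T)"
  by (simp add: free_tuples_def)

text \<open>The term at i of one expansion equals the term at \<open>mdeg s T - i\<close> of the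
  other: the powers of P cancel, and \<open>2 * D s = mdeg s T\<close> aligns the powers of
  x_s.\<close>

lemma is_cs_pairI:
  assumes "bij \<sigma>" "is_seedlet s \<omega>" "type_rep F T d"
    and "d' \<in> free_tuples T d s \<sigma>" "mdeg (inv \<sigma> s) T = mdeg s T"
    and match: "coefs_match T s \<sigma> (exchange_poly \<omega>)"
  shows "is_cs_pair F \<sigma> s \<omega> d'"
proof -
  define D where "D = (\<lambda>i. d i + d' i)"
  let ?t = "inv \<sigma> s" and ?M = "mdeg s T" and ?P = "exchange_poly \<omega>"
  have D: "D (\<sigma> i) = D i" "2 * D s = int ?M" for i
    using assms(4) by (simp_all add: free_tuples_iff D_def)
  have Dinv: "D (inv \<sigma> k) = D k" for k
    using D(1)[of "inv \<sigma> k"] assms(1) by (simp add: bij_is_surj surj_f_inv_f)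
  have P: "?P \<noteq> 0" by (rule exchange_poly_neq_0[OF assms(2)])
  have half: "int (?M div 2) = D s" using D(2) by simp
  let ?M2 = "\<Prod>k\<in>UNIV - {s}. X k powi D k"
  have "(\<Sum>i\<le>?M. (poly_at (coefp ?t i T) (X \<circ> \<sigma>) * ?P powi (int i - D s) / ?M2) * X s powi (D s - int i)) =
      (\<Sum>i\<le>?M. (poly_at (coefp s (?M - i) T) X / ?M2) * X s powi (int (?M - i) - D s))"
  proof (intro sum.cong refl arg_cong2[where f = times])
    fix i assume i: "i \<in> {..?M}"
    then have "poly_at (coefp ?t i T) (X \<circ> \<sigma>) = poly_at (coefp s (?M - i) T) X * ?P powi (D s - int i)"
      using match half by (simp add: coefs_match_def)
    moreover have "?P powi (D s - int i) * ?P powi (int i - D s) = 1"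
      using P by (simp flip: power_int_add)
    ultimately show "poly_at (coefp ?t i T) (X \<circ> \<sigma>) * ?P powi (int i - D s) / ?M2 =
        poly_at (coefp s (?M - i) T) X / ?M2"
      by (simp add: mult.assoc)
    show "X s powi (D s - int i) = X s powi (int (?M - i) - D s)"
      using i D(2) by (intro arg_cong[where f = "\<lambda>k. X s powi k"]) auto
  qed
  also have "\<dots> = (\<Sum>j\<le>?M. (poly_at (coefp s j T) X / ?M2) * X s powi (int j - D s))"
    by (rule sum.reindex_bij_witness[of _ "\<lambda>j. ?M - j" "\<lambda>j. ?M - j"]) auto
  finally show ?thesis
    unfolding is_cs_pair_iff_expansions[OF assms(1-3)] assms(5)
    by (simp add: Dinv flip: D_def)
       (simp add: Dinv[unfolded D_def] D_def)
qed

lemma is_cs_pairD: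
  fixes F :: "'n::{finite,linorder} laurent"
  assumes "bij \<sigma>" "is_seedlet s \<omega>" "type_rep F T d" "is_cs_pair F \<sigma> s \<omega> d'"
  shows "d' \<in> free_tuples T d s \<sigma>" "mdeg (inv \<sigma> s) T = mdeg s T"
    "coefs_match T s \<sigma> (exchange_poly \<omega>)"
proof -
  define D where "D = (\<lambda>i. d i + d' i)"
  define t where "t = inv \<sigma> s"
  define P where "P = exchange_poly \<omega>"
  define M1 where "M1 = (\<Prod>k\<in>UNIV - {s}. X k powi D (inv \<sigma> k))"
  define M2 where "M2 = (\<Prod>k\<in>UNIV - {s}. X k powi D k)"
  define A where "A = (\<lambda>i. poly_at (coefp t i T) (X \<circ> \<sigma>))"
  define B where "B = (\<lambda>i. poly_at (coefp s i T) X)"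
  have nd: "\<not> pvar k dvd T" for k using assms(3) by (simp add: type_rep_def)
  then have T: "T \<noteq> 0" by auto
  have P: "P \<noteq> 0" using exchange_poly_neq_0[OF assms(2)] by (simp add: P_def)
  have nz: "M1 \<noteq> 0" "M2 \<noteq> 0" by (simp_all add: M1_def M2_def)
  have free: "free_of s M1" "free_of s M2"
    unfolding M1_def M2_def by (auto intro!: free_of_prod free_of_powi free_of_X)
  have freeP: "free_of s P" unfolding P_def by (rule free_of_exchange_poly[OF assms(2)])
  have A0_iff: "A i = 0 \<longleftrightarrow> coefp t i T = 0" for i
    by (simp add: A_def poly_at_perm_eq_0_iff[OF assms(1)])
  have B0_iff: "B i = 0 \<longleftrightarrow> coefp s i T = 0" for i
    by (simp add: B_def poly_at_X_eq_0_iff)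
  define a where "a = (\<lambda>i. A i * P powi (int i - D t) / M1)"
  define b where "b = (\<lambda>j. B j / M2)"
  have a0_iff: "a i = 0 \<longleftrightarrow> coefp t i T = 0" for i
    using nz P by (simp add: a_def A0_iff)
  have b0_iff: "b j = 0 \<longleftrightarrow> coefp s j T = 0" for j
    using nz by (simp add: b_def B0_iff)
  have eq: "(\<Sum>i\<le>mdeg t T. a i * X s powi (D t - int i)) = (\<Sum>j\<le>mdeg s T. b j * X s powi (int j - D s))"
    using is_cs_pair_iff_expansions[OF assms(1-3), of d'] assms(4)
    by (simp add: a_def b_def A_def B_def t_def P_def M1_def M2_def D_def)
  have freea: "free_of s (a i)" for i
    unfolding a_def A_def t_def using assms(1) free freeP
    by (intro free_of_divide free_of_mult free_of_powi free_of_perm_coefp)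
  have freeb: "free_of s (b j)" for j
    unfolding b_def B_def using free by (intro free_of_divide free_of_coefp)
  have za: "a i = 0" if "i > mdeg t T" for i using that by (simp add: a0_iff coefp_beyond)
  have zb: "b j = 0" if "j > mdeg s T" for j using that by (simp add: b0_iff coefp_beyond)
  note expansions = free_of_expansions_eq[OF freea za freeb zb eq]
  have a_0: "a 0 \<noteq> 0" and a_N: "a (mdeg t T) \<noteq> 0"
    by (simp_all add: a0_iff coefp_0_neq_0[OF nd] coefp_mdeg_neq_0[OF T])
  have b_0: "b 0 \<noteq> 0" and b_M: "b (mdeg s T) \<noteq> 0"
    by (simp_all add: b0_iff coefp_0_neq_0[OF nd] coefp_mdeg_neq_0[OF T])
  \<comment> \<open>The nonzero end coefficients squeeze the ranges. \<open>a 0\<close> has a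
    partner at D_t + D_s, which must lie between 0 and \<open>mdeg s T\<close>;
    \<open>b (mdeg s T)\<close> needs a partner too, so the sum equals \<open>mdeg s T\<close>. The
    other two ends then identify the two degrees.\<close>
  have pos: "D t + D s \<ge> 0" using expansions(2)[of 0] a_0 by fastforce
  have "b (nat (D t + D s)) \<noteq> 0" using expansions(1)[of 0] a_0 pos by simp
  then have le: "nat (D t + D s) \<le> mdeg s T" using zb by (meson not_le)
  have "\<not> D t + D s - int (mdeg s T) < 0" using expansions(3)[of "mdeg s T"] b_M by blast
  with le pos have M: "int (mdeg s T) = D t + D s" by simp
  have "\<not> D t - int (mdeg t T) + D s < 0" using expansions(2)[of "mdeg t T"] a_N by blast
  then have N_le: "mdeg t T \<le> mdeg s T" using M by simp
  have "a (mdeg s T) = b 0" using expansions(1)[of "mdeg s T"] M by simp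
  then have "mdeg s T \<le> mdeg t T" using b_0 za by (metis not_le)
  with N_le have N: "mdeg t T = mdeg s T" by simp
  have ab: "a i = b (mdeg s T - i)" if "i \<le> mdeg s T" for i
    using expansions(1)[of i] M that by (simp add: nat_diff_distrib' flip: of_nat_diff)
      (metis diff_add_eq add.commute nat_int of_nat_diff)
  show "mdeg (inv \<sigma> s) T = mdeg s T" using N by (simp add: t_def)

  have Dinv_neq_s: "D (inv \<sigma> k) = D k" if k: "k \<noteq> s" for k
  proof -
    have invk: "inv \<sigma> k \<noteq> t"
      using k assms(1) by (metis bij_inv_eq_iff t_def)
    have val_M: "ord.val k M1 = - D (inv \<sigma> k)" "ord.val k M2 = - D k"
      using k by (simp_all add: M1_def M2_def ord.val_prod ord.val_powi ord_val_X
          if_distrib[of "(*) _"] sum.delta cong: if_cong)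
    have val_P: "ord.val k P = 0"
      unfolding P_def by (rule ord_val_exchange_poly[OF assms(2)])
    have val: "ord.wdeg (inv \<sigma> k) (coefp t i T) + D (inv \<sigma> k) = ord.wdeg k (coefp s (mdeg s T - i) T) + D k"
      if i: "i \<le> mdeg s T" "coefp t i T \<noteq> 0" for i
    proof -
      have nzi: "a i \<noteq> 0" "A i \<noteq> 0" "coefp s (mdeg s T - i) T \<noteq> 0" "B (mdeg s T - i) \<noteq> 0"
        using i ab[OF i(1)] by (auto simp: A0_iff B0_iff a0_iff simp flip: b0_iff)
      have "ord.val k (a i) = ord.val k (A i) + D (inv \<sigma> k)"
        using nzi P nz by (simp add: a_def ord.val_divide ord.val_mult ord.val_powi val_P val_M)
      moreover have "ord.val k (b (mdeg s T - i)) = ord.val k (B (mdeg s T - i)) + D k"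
        using nzi nz by (simp add: b_def ord.val_divide val_M)
      ultimately show ?thesis
        using ab[OF i(1)] i nzi(3) by (simp add: A_def B_def ord_val_perm[OF assms(1)] ord_val_poly_at_X)
    qed
    \<comment> \<open>Because no variable divides T, each side has a coefficient whose order in the
      relevant variable is 0. Its partner has order at least 0, so each choice of side gives one
      inequality.\<close>
    obtain i where i: "i \<le> mdeg s T" "coefp t i T \<noteq> 0" "ord.wdeg (inv \<sigma> k) (coefp t i T) = 0"
      using ord.wdeg_coefp_attained[OF wt_single_neq(2)[OF invk] T]
      by (metis N ord_wdeg_eq_0[OF nd])
    obtain j where j: "j \<le> mdeg s T" "coefp s j T \<noteq> 0" "ord.wdeg k (coefp s j T) = 0"
      using ord.wdeg_coefp_attained[OF wt_single_neq(2)[OF k] T]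
      by (metis ord_wdeg_eq_0[OF nd])
    have "coefp s (mdeg s T - i) T \<noteq> 0"
      using i ab[OF i(1)] by (metis a0_iff b0_iff)
    with val[OF i(1,2)] i(3) have "D (inv \<sigma> k) \<le> D k"
      using ord_wdeg_nonpos[of "coefp s (mdeg s T - i) T" k] by simp
    moreover have j': "coefp t (mdeg s T - j) T \<noteq> 0"
      using j ab[of "mdeg s T - j"] by (metis a0_iff b0_iff diff_diff_cancel diff_le_self)
    have "D k \<le> D (inv \<sigma> k)"
      using val[OF diff_le_self j'] j ord_wdeg_nonpos[OF j', of "inv \<sigma> k"] by simp
    ultimately show ?thesis by simp
  qed
  \<comment> \<open>The identities between coefficients do not involve x_s. The equality at s is
    what remains after cancelling all other summands from two equal sums.\<close>
  have sum: "(\<Sum>k\<in>UNIV. D (inv \<sigma> k)) = (\<Sum>k\<in>UNIV. D k)"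
    by (rule sum.reindex_bij_betw) (rule bij_imp_bij_inv[OF assms(1)])
  have "D (inv \<sigma> s) = D s"
    using sum Dinv_neq_s by (simp add: sum.remove[of UNIV s])
  with Dinv_neq_s have Dinv: "D (inv \<sigma> k) = D k" for k by metis
  have "D (\<sigma> i) = D i" for i
    using Dinv[of "\<sigma> i"] assms(1) by (simp add: bij_is_inj)
  moreover have M': "2 * D s = int (mdeg s T)" using M Dinv[of s] by (simp add: t_def)
  ultimately show "d' \<in> free_tuples T d s \<sigma>"
    by (simp add: free_tuples_iff D_def)
  have "M1 = M2" by (simp add: M1_def M2_def Dinv)
  have half: "int (mdeg s T div 2) = D s" using M' by simp
  have Dt: "D t = D s" using Dinv[of s] by (simp add: t_def)
  have "A i = B (mdeg s T - i) * P powi (D s - int i)" if "i \<le> mdeg s T" for i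
  proof -
    have "A i * P powi (int i - D s) = B (mdeg s T - i)"
      using ab[OF that] nz \<open>M1 = M2\<close> by (simp add: a_def b_def Dt)
    then have "B (mdeg s T - i) * P powi (D s - int i) =
        A i * (P powi (int i - D s) * P powi (D s - int i))"
      by (simp flip: mult.assoc)
    also have "P powi (int i - D s) * P powi (D s - int i) = 1"
      using P by (simp flip: power_int_add)
    finally show ?thesis by simp
  qed
  then show "coefs_match T s \<sigma> (exchange_poly \<omega>)"
    by (simp add: coefs_match_def half A_def B_def t_def P_def)
qed

section \<open>Trivial pairs, and the sets of non-trivial pairs and of cluster symmetric
  maps\<close>

lemma is_trivial_if_mdeg_0:
  assumes "bij \<sigma>" "is_seedlet s \<omega>" "type_rep F T d" "is_cs_pair F \<sigma> s \<omega> d'" "mdeg s T = 0"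
  shows "is_trivial F \<sigma> s d'"
proof -
  note D = is_cs_pairD[OF assms(1-4)]
  have mt: "mdeg (inv \<sigma> s) T = 0" using D(2) assms(5) by simp
  \<comment> \<open>In degree 0 both expansions consist of their constant term, and the matching
    identity carries P to the power 0.\<close>
  have "poly_at T (X \<circ> \<sigma>) = poly_at (coefp (inv \<sigma> s) 0 T) (X \<circ> \<sigma>)"
    by (simp add: poly_at_coefp_sum[of T "X \<circ> \<sigma>" "inv \<sigma> s"] mt)
  also have "\<dots> = poly_at (coefp s 0 T) X"
    using D(3) assms(5) by (simp add: coefs_match_def)
  also have "\<dots> = poly_at T X"
    by (simp add: poly_at_coefp_sum[of T X s] assms(5))
  finally show ?thesis
    using assms(3,5) mt D(1) unfolding is_trivial_def free_tuples_iff
    by (intro exI[of _ T] exI[of _ d]) simp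
qed

lemma is_trivial_mdeg_0:
  assumes "type_rep F T d" "is_trivial F \<sigma> s d'"
  shows "mdeg s T = 0"
  using assms type_rep_unique unfolding is_trivial_def by blast

definition pairs_for ::
    "'n::{finite,linorder} mpoly \<Rightarrow> ('n \<Rightarrow> int) \<Rightarrow> 'n \<Rightarrow> ('n \<Rightarrow> 'n) \<Rightarrow> 'n cs_pairs" where
  "pairs_for T d s \<sigma> = {(cs_map \<sigma> s \<omega>, d') | \<omega> d'. is_seedlet s \<omega> \<and>
     coefs_match T s \<sigma> (exchange_poly \<omega>) \<and> d' \<in> free_tuples T d s \<sigma>}"

text \<open>The pairs split along the two outer loops: 2 (d_s + d'_s) = \<eta>_s makes \<eta>_s
  even, non-triviality makes it nonzero, and equality of the degrees along s and t puts \<sigma>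
  into \<open>Sigma_init\<close>.\<close>

lemma nontrivial_cs_pairs_eq:
  assumes "type_rep F T d"
  shows "nontrivial_cs_pairs F = (\<Union>s\<in>even_dirs T. \<Union>\<sigma>\<in>Sigma_init T s. pairs_for T d s \<sigma>)"
proof (intro equalityI subsetI)
  fix x assume "x \<in> nontrivial_cs_pairs F"
  then obtain \<sigma> s \<omega> d' where x: "x = (cs_map \<sigma> s \<omega>, d')"
    and *: "bij \<sigma>" "is_seedlet s \<omega>" "is_cs_pair F \<sigma> s \<omega> d'" "\<not> is_trivial F \<sigma> s d'"
    by (auto simp: nontrivial_cs_pairs_def)
  note D = is_cs_pairD[OF *(1,2) assms *(3)]
  have nz: "mdeg s T \<noteq> 0" using is_trivial_if_mdeg_0[OF *(1,2) assms *(3)] *(4) by blast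
  have "int (mdeg s T) = 2 * (d s + d' s)" using D(1) by (simp add: free_tuples_iff)
  then have "even (int (mdeg s T))" by simp
  with nz D(2) have "s \<in> even_dirs T" "\<sigma> \<in> Sigma_init T s"
    using *(1) by (simp_all add: even_dirs_def Sigma_init_def)
  moreover have "x \<in> pairs_for T d s \<sigma>"
    unfolding pairs_for_def x using *(2) D by blast
  ultimately show "x \<in> (\<Union>s\<in>even_dirs T. \<Union>\<sigma>\<in>Sigma_init T s. pairs_for T d s \<sigma>)" by blast
next
  fix x assume "x \<in> (\<Union>s\<in>even_dirs T. \<Union>\<sigma>\<in>Sigma_init T s. pairs_for T d s \<sigma>)"
  then obtain s \<sigma> \<omega> d' where *: "s \<in> even_dirs T" "\<sigma> \<in> Sigma_init T s" "x = (cs_map \<sigma> s \<omega>, d')"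
    "is_seedlet s \<omega>" "coefs_match T s \<sigma> (exchange_poly \<omega>)" "d' \<in> free_tuples T d s \<sigma>"
    by (auto simp: pairs_for_def)
  then have "is_cs_pair F \<sigma> s \<omega> d'"
    using assms by (intro is_cs_pairI) (auto simp: Sigma_init_def)
  moreover have "\<not> is_trivial F \<sigma> s d'"
    using is_trivial_mdeg_0[OF assms] *(1) by (auto simp: even_dirs_def)
  moreover have "bij \<sigma>" using *(2) by (simp add: Sigma_init_def)
  ultimately show "x \<in> nontrivial_cs_pairs F"
    unfolding nontrivial_cs_pairs_def using *(3,4) by blast
qed

text \<open>For d' = 0 the monomial factor is 1, so being a pair means leaving F invariant. Among
  pairs, non-triviality is exactly the condition \<eta>_s \<noteq> 0.\<close>

lemma cluster_symmetric_set_eq: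
  fixes F :: "'a::{finite,linorder} laurent"
  assumes "type_rep F T d"
  shows "cluster_symmetric_set F = {\<psi>. (\<psi>, \<lambda>_. 0) \<in> nontrivial_cs_pairs F}"
proof -
  have "laurent_monom (\<lambda>i. 0) = (1 :: 'a laurent)"
    by (simp add: laurent_monom_def)
  then have pair: "is_cs_pair F \<sigma> s \<omega> (\<lambda>_. 0) \<longleftrightarrow> laurent_at F (cs_map \<sigma> s \<omega>) = laurent_at F X" for \<sigma> s \<omega>
    by (simp add: is_cs_pair_def)
  have ex: "(\<exists>T d. type_rep F T d \<and> mdeg s T \<noteq> 0) \<longleftrightarrow> mdeg s T \<noteq> 0" for s
    using assms type_rep_unique[OF assms] by metis
  have triv: "is_trivial F \<sigma> s (\<lambda>_. 0) \<longleftrightarrow> mdeg s T = 0"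
    if "bij \<sigma>" "is_seedlet s \<omega>" "is_cs_pair F \<sigma> s \<omega> (\<lambda>_. 0)" for \<sigma> s \<omega>
    using is_trivial_if_mdeg_0[OF that(1,2) assms that(3)] is_trivial_mdeg_0[OF assms] by blast
  show ?thesis
  proof (intro equalityI subsetI)
    fix \<psi> assume "\<psi> \<in> cluster_symmetric_set F"
    then obtain \<sigma> s \<omega> where *: "\<psi> = cs_map \<sigma> s \<omega>" "bij \<sigma>" "is_seedlet s \<omega>"
      "is_cs_pair F \<sigma> s \<omega> (\<lambda>_. 0)" "mdeg s T \<noteq> 0"
      unfolding cluster_symmetric_set_def ex pair by blast
    then have "\<not> is_trivial F \<sigma> s (\<lambda>_. 0)" using triv[OF *(2-4)] by simp
    with * show "\<psi> \<in> {\<psi>. (\<psi>, \<lambda>_. 0) \<in> nontrivial_cs_pairs F}"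
      unfolding nontrivial_cs_pairs_def by blast
  next
    fix \<psi> assume "\<psi> \<in> {\<psi>. (\<psi>, \<lambda>_. 0) \<in> nontrivial_cs_pairs F}"
    then obtain \<sigma> s \<omega> where *: "\<psi> = cs_map \<sigma> s \<omega>" "bij \<sigma>" "is_seedlet s \<omega>"
      "is_cs_pair F \<sigma> s \<omega> (\<lambda>_. 0)" "\<not> is_trivial F \<sigma> s (\<lambda>_. 0)"
      unfolding nontrivial_cs_pairs_def by blast
    then have "mdeg s T \<noteq> 0" using triv[OF *(2-4)] by simp
    with * show "\<psi> \<in> cluster_symmetric_set F"
      unfolding cluster_symmetric_set_def ex pair by blast
  qed
qed

section \<open>Correctness of the search space\<close>

text \<open>Let h be half of \<eta>_s. By the identity at i, the degrees of matched coefficients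
  differ by (h - i) r |b_k|. At i = 0 and i = 2h this bounds h r |b_k| by the degrees of T in the
  two variables; at an index attaining such a degree it bounds their difference, as |h - i| \<le>
  h.\<close>

lemma in_W_init:
  assumes "type_rep F T d" "s \<in> even_dirs T" "\<sigma> \<in> Sigma_init T s"
    and seed: "is_seedlet s (b, r, Z)" and match: "coefs_match T s \<sigma> (exchange_poly (b, r, Z))"
  shows "(b, r) \<in> W_init T s \<sigma>"
proof -
  define t where "t = inv \<sigma> s"
  define P where "P = exchange_poly (b, r, Z)"
  define M where "M = mdeg s T"
  define h where "h = M div 2"
  have nd: "\<not> pvar k dvd T" for k using assms(1) by (simp add: type_rep_def)
  then have T: "T \<noteq> 0" by auto
  have M: "M = 2 * h" using assms(2) by (simp add: even_dirs_def M_def h_def)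
  have \<sigma>: "bij \<sigma>" and N: "mdeg t T = M"
    using assms(3) by (simp_all add: Sigma_init_def t_def M_def)
  have P: "P \<noteq> 0" using exchange_poly_neq_0[OF seed] by (simp add: P_def)
  have eq: "poly_at (coefp t i T) (X \<circ> \<sigma>) = poly_at (coefp s (M - i) T) X * P powi (int h - int i)"
    if "i \<le> M" for i
    using match that by (simp add: coefs_match_def M_def h_def t_def P_def)
  have b: "b s = 0" "r > 0" using seed by (simp_all add: is_seedlet_def)
  have bounds: "int h * (int r * \<bar>b k\<bar>) \<le> int (mdeg k T)"
    "int h * (int r * \<bar>b k\<bar>) \<le> int (mdeg (inv \<sigma> k) T)"
    "\<bar>int (mdeg k T) - int (mdeg (inv \<sigma> k) T)\<bar> \<le> int h * (int r * \<bar>b k\<bar>)" for k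
  proof (atomize(full), cases "k = s")
    case True
    then show "int h * (int r * \<bar>b k\<bar>) \<le> int (mdeg k T) \<and>
      int h * (int r * \<bar>b k\<bar>) \<le> int (mdeg (inv \<sigma> k) T) \<and>
      \<bar>int (mdeg k T) - int (mdeg (inv \<sigma> k) T)\<bar> \<le> int h * (int r * \<bar>b k\<bar>)"
      using b N by (simp add: t_def M_def)
  next
    case k: False
    have invk: "inv \<sigma> k \<noteq> t"
      using k \<sigma> by (metis bij_inv_eq_iff t_def)
    define \<beta> where "\<beta> = int r * \<bar>b k\<bar>"
    have \<beta>: "\<beta> \<ge> 0" by (simp add: \<beta>_def)
    have val_P: "deg.val k P = \<beta>"
      unfolding P_def \<beta>_def by (rule deg_val_exchange_poly[OF seed])
    have nz_iff: "coefp t i T = 0 \<longleftrightarrow> coefp s (M - i) T = 0" if "i \<le> M" for i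
      using eq[OF that] P poly_at_perm_eq_0_iff[OF \<sigma>, of "coefp t i T"]
      by (auto simp: poly_at_X_eq_0_iff)
    have val: "deg.wdeg (inv \<sigma> k) (coefp t i T) = deg.wdeg k (coefp s (M - i) T) + (int h - int i) * \<beta>"
      if i: "i \<le> M" "coefp t i T \<noteq> 0" for i
    proof -
      have "coefp s (M - i) T \<noteq> 0" using nz_iff i by blast
      then show ?thesis
        using arg_cong[OF eq[OF i(1)], of "deg.val k"] P i(2)
        by (simp add: deg_val_perm[OF \<sigma>] deg.val_mult deg.val_powi val_P
            poly_at_X_eq_0_iff deg_val_poly_at_X)
    qed
    have le_t: "deg.wdeg (inv \<sigma> k) (coefp t i T) \<le> int (mdeg (inv \<sigma> k) T)" if "coefp t i T \<noteq> 0" for i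
      using deg.wdeg_coefp_le[OF wt_single_neq(1)[OF invk] that] by (simp add: deg_wdeg_eq_mdeg[OF T])
    have le_s: "deg.wdeg k (coefp s i T) \<le> int (mdeg k T)" if "coefp s i T \<noteq> 0" for i
      using deg.wdeg_coefp_le[OF wt_single_neq(1)[OF k] that] by (simp add: deg_wdeg_eq_mdeg[OF T])
    have t0: "coefp t 0 T \<noteq> 0" by (rule coefp_0_neq_0[OF nd])
    have sM: "coefp s M T \<noteq> 0" using nz_iff[of 0] t0 by simp
    have s0: "coefp s 0 T \<noteq> 0" by (rule coefp_0_neq_0[OF nd])
    have tM: "coefp t M T \<noteq> 0" using nz_iff[of M] s0 by simp
    have 1: "int h * \<beta> \<le> int (mdeg (inv \<sigma> k) T)"
      using val[of 0] t0 le_t[OF t0] deg_wdeg_nonneg[OF sM, of k] by simp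
    have 2: "int h * \<beta> \<le> int (mdeg k T)"
      using val[of M] tM le_s[OF s0] deg_wdeg_nonneg[OF tM, of "inv \<sigma> k"] by (simp add: M algebra_simps)
    obtain i where i: "i \<le> M" "coefp t i T \<noteq> 0" "deg.wdeg (inv \<sigma> k) (coefp t i T) = int (mdeg (inv \<sigma> k) T)"
      using deg.wdeg_coefp_attained[OF wt_single_neq(1)[OF invk] T]
      by (metis N deg_wdeg_eq_mdeg[OF T])
    have "(int h - int i) * \<beta> \<le> int h * \<beta>" using \<beta> by (intro mult_right_mono) auto
    moreover have "coefp s (M - i) T \<noteq> 0" using nz_iff i by blast
    ultimately have 3: "int (mdeg (inv \<sigma> k) T) - int (mdeg k T) \<le> int h * \<beta>"
      using val[OF i(1,2)] i(3) le_s[of "M - i"] by linarith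
    obtain j where j: "j \<le> M" "coefp s j T \<noteq> 0" "deg.wdeg k (coefp s j T) = int (mdeg k T)"
      using deg.wdeg_coefp_attained[OF wt_single_neq(1)[OF k] T]
      by (metis M_def deg_wdeg_eq_mdeg[OF T])
    have j': "coefp t (M - j) T \<noteq> 0" using nz_iff[of "M - j"] j by simp
    \<comment> \<open>As M = 2h, the factor on the left is h - j.\<close>
    have "- (int h - int (M - j)) * \<beta> \<le> int h * \<beta>"
      using \<beta> j(1) M by (intro mult_right_mono) auto
    then have 4: "int (mdeg k T) - int (mdeg (inv \<sigma> k) T) \<le> int h * \<beta>"
      using val[of "M - j"] j j' le_t[OF j'] by (simp add: algebra_simps)
    from 1 2 3 4 show "int h * (int r * \<bar>b k\<bar>) \<le> int (mdeg k T) \<and>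
      int h * (int r * \<bar>b k\<bar>) \<le> int (mdeg (inv \<sigma> k) T) \<and>
      \<bar>int (mdeg k T) - int (mdeg (inv \<sigma> k) T)\<bar> \<le> int h * (int r * \<bar>b k\<bar>)"
      by (simp add: \<beta>_def abs_le_iff)
  qed
  have half: "rat_of_nat (mdeg s T) / 2 * rat_of_nat r * rat_of_int \<bar>b k\<bar> =
      rat_of_int (int h * (int r * \<bar>b k\<bar>))" for k
    using M by (simp add: M_def)
  have absq: "\<bar>rat_of_nat x - rat_of_nat y\<bar> = rat_of_int \<bar>int x - int y\<bar>" for x y by simp
  have "rat_of_int (int h * (int r * \<bar>b k\<bar>)) \<le> rat_of_int (int (min (mdeg k T) (mdeg (inv \<sigma> k) T)))" for k
    unfolding of_int_le_iff using bounds(1,2)[of k] by simp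
  moreover have "rat_of_int \<bar>int (mdeg k T) - int (mdeg (inv \<sigma> k) T)\<bar> \<le> rat_of_int (int h * (int r * \<bar>b k\<bar>))" for k
    unfolding of_int_le_iff by (rule bounds(3))
  ultimately show ?thesis
    using b by (simp add: W_init_def half absq del: of_int_mult of_int_abs of_int_diff times_divide_eq_left)
qed

text \<open>Some |b_k| is at least 1, and h \<ge> 1, so r \<le> h r |b_k|, which is at most a degree
  of T. The same inequality bounds every entry of b.\<close>

lemma finite_W_init_nonzero:
  fixes T :: "'a::{finite,linorder} mpoly"
  assumes "s \<in> even_dirs T"
  shows "finite {(b, r). (b, r) \<in> W_init T s \<sigma> \<and> b \<noteq> (\<lambda>_. 0)}"
proof -
  define h where "h = mdeg s T div 2"
  have M: "mdeg s T = 2 * h" "h > 0" using assms by (auto simp: even_dirs_def h_def)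
  define N where "N = Max (range (\<lambda>k. mdeg k T))"
  have N: "mdeg k T \<le> N" for k unfolding N_def by (rule Max_ge) auto
  have "{(b, r). (b, r) \<in> W_init T s \<sigma> \<and> b \<noteq> (\<lambda>_. 0)} \<subseteq>
      {b. range b \<subseteq> {- int N..int N}} \<times> {..N}"
  proof clarify
    fix b r assume *: "(b, r) \<in> W_init T s \<sigma>" "b \<noteq> (\<lambda>_. 0)"
    have r: "r > 0" using * by (simp add: W_init_def)
    have le: "int r * \<bar>b k\<bar> \<le> int N" for k
    proof -
      have "rat_of_nat (mdeg s T) / 2 * rat_of_nat r * rat_of_int \<bar>b k\<bar> \<le>
          rat_of_nat (min (mdeg k T) (mdeg (inv \<sigma> k) T))"
        using *(1) by (auto simp: W_init_def)
      also have "rat_of_nat (mdeg s T) / 2 * rat_of_nat r * rat_of_int \<bar>b k\<bar> =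
          rat_of_int (int h * (int r * \<bar>b k\<bar>))" using M by simp
      also have "rat_of_nat (min (mdeg k T) (mdeg (inv \<sigma> k) T)) =
          rat_of_int (int (min (mdeg k T) (mdeg (inv \<sigma> k) T)))" by simp
      finally have "int h * (int r * \<bar>b k\<bar>) \<le> int (min (mdeg k T) (mdeg (inv \<sigma> k) T))"
        unfolding of_int_le_iff .
      also have "\<dots> \<le> int N" using N[of k] by simp
      finally have "int h * (int r * \<bar>b k\<bar>) \<le> int N" .
      moreover have "1 * (int r * \<bar>b k\<bar>) \<le> int h * (int r * \<bar>b k\<bar>)"
        using M(2) by (intro mult_right_mono) auto
      ultimately show ?thesis by simp
    qed
    have "\<bar>b k\<bar> \<le> int N" for k
    proof -
      have "1 * \<bar>b k\<bar> \<le> int r * \<bar>b k\<bar>" using r by (intro mult_right_mono) auto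
      with le[of k] show ?thesis by simp
    qed
    then have "range b \<subseteq> {- int N..int N}" by (auto simp: abs_le_iff minus_le_iff)
    moreover obtain k where "b k \<noteq> 0" using *(2) by auto
    then have "int r * 1 \<le> int r * \<bar>b k\<bar>" by (intro mult_left_mono) auto
    with le[of k] have "r \<le> N" by simp
    ultimately show "b \<in> {b. range b \<subseteq> {- int N..int N}} \<and> r \<in> {..N}" by simp
  qed
  moreover have "finite {b :: 'a \<Rightarrow> int. range b \<subseteq> {- int N..int N}}"
    using finite_set_of_finite_funs[of "UNIV :: 'a set" "{- int N..int N}" 0]
    by (simp add: image_subset_iff)
  ultimately show ?thesis by (auto intro: finite_subset)
qed

text \<open>For b = 0 only the value Z(1) matters. It is at least 2, as z_0 and z_r are positive
  coefficients at different indices, and each such value is reached with any length. This justifies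
  removing all (0, r') at once.\<close>

lemma constant_seedlet_any_length:
  fixes s :: "'a::{finite,linorder}"
  assumes "is_seedlet s (\<lambda>_. 0, r, Z)" "r' > 0"
  shows "\<exists>Z'. is_seedlet s (\<lambda>_. 0, r', Z') \<and> 
    (exchange_poly (\<lambda>_. 0, r', Z') :: 'a ratfun) = exchange_poly (\<lambda>_. 0, r, Z)"
proof -
  have Z: "degree Z \<le> r" "r > 0" "coeff Z 0 > 0" "coeff Z r > 0"
    using assms(1) by (auto simp: is_seedlet_def)
  define c where "c = poly Z 1"
  have "coeff Z 0 + coeff Z r \<le> (\<Sum>i\<in>{0, r}. coeff Z i)" using Z by simp
  also have "\<dots> \<le> (\<Sum>i\<le>r. coeff Z i)" by (rule sum_mono2) auto
  also have "\<dots> = c" using poly_sum_atMost[OF Z(1), of 1] by (simp add: c_def)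
  finally have c: "c \<ge> 2" using Z by simp
  \<comment> \<open>A polynomial of degree r' with value c at 1; c \<ge> 2 keeps its constant term
    positive.\<close>
  define Z' where "Z' = [:c - 1:] + monom 1 r'"
  have "degree Z' \<le> r'" unfolding Z'_def
    by (rule degree_add_le) (auto simp: degree_monom_le)
  then have seed: "is_seedlet s (\<lambda>_. 0, r', Z')"
    using c assms(2) by (auto simp: is_seedlet_def Z'_def coeff_pCons split: nat.splits)
  have exch: "exchange_poly (\<lambda>_. 0, q, Y) = (of_nat (poly Y 1) :: 'a ratfun)" for q and Y :: "nat poly"
  proof -
    have "poly (map_poly of_nat Y) 1 = (of_nat (poly Y 1) :: 'a ratfun)"
      using poly_sum_atMost[of "map_poly of_nat Y :: 'a ratfun poly" "degree Y" 1]
      by (simp add: poly_altdef coeff_map_poly degree_le coeff_eq_0)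
    then show ?thesis by (simp add: exchange_poly_def monom_at_def)
  qed
  have "poly Z' 1 = c" using c by (simp add: Z'_def poly_monom)
  then show ?thesis using seed by (intro exI[of _ Z']) (simp add: exch c_def)
qed

section \<open>The root extraction step\<close>

text \<open>A root that passes satisfies all the identities. Conversely, the identity at k0 makes a
  matching exchange polynomial a positive root of the same element, with exponent h - k0 > 0, so it
  is P. The choice of k0 thus has no influence on which seedlets are found.\<close>

lemma P_passes_iff_exchange_poly:
  assumes "type_rep F T d" "\<sigma> \<in> Sigma_init T s" "mdeg s T = 2 * h"
    and "expansion s T fs" "expansion (inv \<sigma> s) T ft" "k0_choice h fs ft k0"
    and "P_passes h fs ft \<sigma> k0 P" "is_seedlet s \<omega>"
  shows "coefs_match T s \<sigma> (exchange_poly \<omega>) \<longleftrightarrow> P = exchange_poly \<omega>"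
proof -
  have N: "mdeg (inv \<sigma> s) T = 2 * h" using assms(2,3) by (simp add: Sigma_init_def)
  have fs: "fs i = coefp s i T" if "i \<le> 2 * h" for i
    using expansion_unique[OF assms(4)] that assms(3) by simp
  have ft: "ft i = coefp (inv \<sigma> s) i T" if "i \<le> 2 * h" for i
    using expansion_unique[OF assms(5)] that N by simp
  have match: "coefs_match T s \<sigma> Q \<longleftrightarrow>
      (\<forall>i\<le>2 * h. poly_at (ft i) (X \<circ> \<sigma>) = poly_at (fs (2 * h - i)) X * Q powi (int h - int i))" for Q
    by (auto simp: coefs_match_def assms(3) fs ft)
  have k0: "k0 < h" "fs (2 * h - k0) \<noteq> 0" using assms(6) by (simp_all add: k0_choice_def)
  then have nz: "poly_at (fs (2 * h - k0)) X \<noteq> 0" by (simp add: poly_at_X_eq_0_iff)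
  show ?thesis
  proof
    assume "coefs_match T s \<sigma> (exchange_poly \<omega>)"
    then have "poly_at (ft k0) (X \<circ> \<sigma>) = poly_at (fs (2 * h - k0)) X * exchange_poly \<omega> powi (int h - int k0)"
      using k0(1) by (simp add: match)
    also have "int h - int k0 = int (h - k0)" using k0(1) by simp
    finally have "exchange_poly \<omega> ^ (h - k0) = poly_at (ft k0) (X \<circ> \<sigma>) / poly_at (fs (2 * h - k0)) X"
      by (simp only: power_int_of_nat nonzero_mult_div_cancel_left[OF nz])
    moreover have "is_root (h - k0) (poly_at (ft k0) (X \<circ> \<sigma>) / poly_at (fs (2 * h - k0)) X) P"
      using assms(7) by (simp add: P_passes_def)
    ultimately show "P = exchange_poly \<omega>"
      using is_root_unique ratfun_pos_exchange_poly[OF assms(8)] k0(1) by (metis zero_less_diff)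
  next
    assume "P = exchange_poly \<omega>"
    then show "coefs_match T s \<sigma> (exchange_poly \<omega>)"
      using assms(7) by (simp add: P_passes_def match)
  qed
qed

text \<open>A matching exchange polynomial itself passes the test; hence a failed test excludes
  every seedlet for this \<sigma>.\<close>

lemma P_passes_exchange_poly:
  assumes "type_rep F T d" "\<sigma> \<in> Sigma_init T s" "mdeg s T = 2 * h"
    and "expansion s T fs" "expansion (inv \<sigma> s) T ft" "k0_choice h fs ft k0"
    and "is_seedlet s \<omega>" "coefs_match T s \<sigma> (exchange_poly \<omega>)"
  shows "P_passes h fs ft \<sigma> k0 (exchange_poly \<omega>)"
proof -
  have N: "mdeg (inv \<sigma> s) T = 2 * h" using assms(2,3) by (simp add: Sigma_init_def)
  have fs: "fs i = coefp s i T" if "i \<le> 2 * h" for i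
    using expansion_unique[OF assms(4)] that assms(3) by simp
  have ft: "ft i = coefp (inv \<sigma> s) i T" if "i \<le> 2 * h" for i
    using expansion_unique[OF assms(5)] that N by simp
  have eq: "poly_at (ft i) (X \<circ> \<sigma>) = poly_at (fs (2 * h - i)) X * exchange_poly \<omega> powi (int h - int i)"
    if "i \<le> 2 * h" for i
    using assms(8) that by (simp add: coefs_match_def assms(3) fs ft)
  have k0: "k0 < h" "fs (2 * h - k0) \<noteq> 0" using assms(6) by (simp_all add: k0_choice_def)
  then have nz: "poly_at (fs (2 * h - k0)) X \<noteq> 0" by (simp add: poly_at_X_eq_0_iff)
  have "int h - int k0 = int (h - k0)" using k0(1) by simp
  moreover have "poly_at (ft k0) (X \<circ> \<sigma>) = poly_at (fs (2 * h - k0)) X * exchange_poly \<omega> powi (int h - int k0)"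
    using eq k0(1) by simp
  ultimately have "exchange_poly \<omega> ^ (h - k0) = poly_at (ft k0) (X \<circ> \<sigma>) / poly_at (fs (2 * h - k0)) X"
    by (simp only: power_int_of_nat nonzero_mult_div_cancel_left[OF nz])
  then show ?thesis
    using eq ratfun_pos_exchange_poly[OF assms(7)] by (simp add: P_passes_def is_root_def)
qed

text \<open>k0 = 0 is always admissible: the constant coefficient along t is nonzero because x_t
  does not divide T, the top coefficient along s is nonzero, and h > 0.\<close>

lemma k0_choice_exists:
  assumes "type_rep F T d" "s \<in> even_dirs T" "\<sigma> \<in> Sigma_init T s"
  obtains h fs ft k0 where "mdeg s T = 2 * h" "expansion s T fs" "expansion (inv \<sigma> s) T ft"
    "k0_choice h fs ft k0"
proof -
  obtain h where h: "mdeg s T = 2 * h" "h > 0" using assms(2) by (auto simp: even_dirs_def elim: evenE)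
  have nd: "\<not> pvar k dvd T" for k using assms(1) by (simp add: type_rep_def)
  then have T: "T \<noteq> 0" by auto
  have "k0_choice h (\<lambda>i. coefp s i T) (\<lambda>i. coefp (inv \<sigma> s) i T) 0"
    using h coefp_0_neq_0[OF nd] coefp_mdeg_neq_0[OF T, of s] by (simp add: k0_choice_def)
  with h(1) show ?thesis using that expansion_coefp by blast
qed

section \<open>The routine\<close>

text \<open>The part of the answer for directions that have left S. It depends only on what is left
  of S, so the invariant prescribes M whatever order the choices were made in;
  \<open>handled_at\<close> does the same for \<Sigma>.\<close>

definition handled ::
    "'n::{finite,linorder} mpoly \<Rightarrow> ('n \<Rightarrow> int) \<Rightarrow> 'n set \<Rightarrow> 'n cs_pairs" where
  "handled T d S = (\<Union>s\<in>even_dirs T - S. \<Union>\<sigma>\<in>Sigma_init T s. pairs_for T d s \<sigma>)"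

definition handled_at ::
    "'n::{finite,linorder} mpoly \<Rightarrow> ('n \<Rightarrow> int) \<Rightarrow> 'n \<Rightarrow> ('n \<Rightarrow> 'n) set \<Rightarrow> 'n cs_pairs" where
  "handled_at T d s \<Sigma> = (\<Union>\<sigma>\<in>Sigma_init T s - \<Sigma>. pairs_for T d s \<sigma>)"

text \<open>In the innermost loop either all pairs for \<open>\<sigma>\<close> have been found already, which happens at the first
  hit because the map depends on the seedlet only through \<open>P\<close>, or nothing removed from \<open>W\<close> was a hit.\<close>

fun routine_inv :: "'n::{finite,linorder} mpoly \<Rightarrow> ('n \<Rightarrow> int) \<Rightarrow> 'n state \<Rightarrow> bool" where
  "routine_inv T d Start = True"
| "routine_inv T d (At_2 S M) = (S \<subseteq> even_dirs T \<and> M = handled T d S)"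
| "routine_inv T d (At_a S s \<Sigma> M) =
     (s \<in> S \<and> S \<subseteq> even_dirs T \<and> \<Sigma> \<subseteq> Sigma_init T s \<and> M = handled T d S \<union> handled_at T d s \<Sigma>)"
| "routine_inv T d (At_A S s \<Sigma> \<sigma> P W M) =
     (s \<in> S \<and> S \<subseteq> even_dirs T \<and> \<Sigma> \<subseteq> Sigma_init T s \<and> \<sigma> \<in> \<Sigma> \<and> W \<subseteq> W_init T s \<sigma> \<and>
      (\<forall>\<omega>. is_seedlet s \<omega> \<longrightarrow> coefs_match T s \<sigma> (exchange_poly \<omega>) \<longleftrightarrow> P = exchange_poly \<omega>) \<and>
      (M = handled T d S \<union> handled_at T d s \<Sigma> \<union> pairs_for T d s \<sigma> \<or>
       M = handled T d S \<union> handled_at T d s \<Sigma> \<and>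
         (\<forall>b r Z. (b, r) \<in> W_init T s \<sigma> - W \<longrightarrow> \<not> (is_seedlet s (b, r, Z) \<and> P = exchange_poly (b, r, Z)))))"
| "routine_inv T d (Stop M) = (M = handled T d {})"

lemma handled_at_remove:
  "\<sigma> \<in> Sigma_init T s \<Longrightarrow> \<sigma> \<in> \<Sigma> \<Longrightarrow> handled_at T d s (\<Sigma> - {\<sigma>}) = handled_at T d s \<Sigma> \<union> pairs_for T d s \<sigma>"
  unfolding handled_at_def by auto

lemma handled_remove:
  "s \<in> even_dirs T \<Longrightarrow> s \<in> S \<Longrightarrow> handled T d (S - {s}) = handled T d S \<union> handled_at T d s {}"
  unfolding handled_def handled_at_def by auto

lemma handled_at_init: "handled_at T d s (Sigma_init T s) = {}"
  by (simp add: handled_at_def)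

lemma pairs_for_exchange:
  assumes "is_seedlet s \<omega>" "coefs_match T s \<sigma> (exchange_poly \<omega>)"
    and "\<And>\<omega>'. is_seedlet s \<omega>' \<Longrightarrow> coefs_match T s \<sigma> (exchange_poly \<omega>') \<Longrightarrow> exchange_poly \<omega>' = exchange_poly \<omega>"
  shows "pairs_for T d s \<sigma> = {(cs_map \<sigma> s \<omega>, d') | d'. d' \<in> free_tuples T d s \<sigma>}"
proof -
  have "cs_map \<sigma> s \<omega>' = cs_map \<sigma> s \<omega>"
    if "is_seedlet s \<omega>'" "coefs_match T s \<sigma> (exchange_poly \<omega>')" for \<omega>'
    unfolding cs_map_def assms(3)[OF that] ..
  then show ?thesis
    unfolding pairs_for_def using assms(1,2) by blast
qed

text \<open>Entries other than (b, r) are removed only for b = 0, and there a seedlet of length r'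
  could be traded for one of length r with the same exchange polynomial.\<close>

lemma treated_no_seedlet:
  fixes P :: "'n::{finite,linorder} ratfun"
  assumes "\<nexists>Z. is_seedlet s (b, r, Z) \<and> P = exchange_poly (b, r, Z)" "r > 0"
    and "(b', r') \<in> treated (b, r)"
  shows "\<not> (is_seedlet s (b', r', Z) \<and> P = exchange_poly (b', r', Z))"
proof (cases "b = (\<lambda>_. 0)")
  case True
  with assms(3) have b': "b' = (\<lambda>_. 0)" by (auto simp: treated_def)
  show ?thesis
    using constant_seedlet_any_length[of s r' Z r] assms(1,2) True b' by metis
next
  case False
  with assms(1,3) show ?thesis by (auto simp: treated_def)
qed

lemma routine_inv_step:
  assumes T: "type_rep F T d"
  shows "routine_step F c c' \<Longrightarrow> routine_inv T d c \<Longrightarrow> routine_inv T d c'"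
proof (induction rule: routine_step.induct)
  case (step_1 T' d')
  then have "T' = T" using T type_rep_unique by blast
  then show ?case by (simp add: handled_def)
next
  case (step_2 M)
  then show ?case by simp
next
  case (step_3 T' d' s S M)
  then have "T' = T" using T type_rep_unique by blast
  with step_3 show ?case by (simp add: handled_at_init)
next
  case (step_a S s M)
  then show ?case using handled_remove[of s T S d] by auto
next
  case (step_b_pass T' d' \<sigma> \<Sigma> s h fs ft k0 P S M)
  then have T': "T' = T" using T type_rep_unique by blast
  have "\<sigma> \<in> Sigma_init T s" using step_b_pass by auto
  then have "is_seedlet s \<omega> \<Longrightarrow> coefs_match T s \<sigma> (exchange_poly \<omega>) \<longleftrightarrow> P = exchange_poly \<omega>" for \<omega>
    using step_b_pass by (intro P_passes_iff_exchange_poly[OF T]) (simp_all add: T')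
  with step_b_pass show ?case by (simp add: T')
next
  case (step_b_fail T' d' \<sigma> \<Sigma> s h fs ft k0 S M)
  then have T': "T' = T" using T type_rep_unique by blast
  have \<sigma>: "\<sigma> \<in> Sigma_init T s" using step_b_fail by auto
  have "\<not> (is_seedlet s \<omega> \<and> coefs_match T s \<sigma> (exchange_poly \<omega>))" for \<omega>
    using P_passes_exchange_poly[OF T \<sigma>, of h fs ft k0 \<omega>] step_b_fail T' by blast
  then have "pairs_for T d s \<sigma> = {}" by (auto simp: pairs_for_def)
  with step_b_fail \<sigma> show ?case by (auto simp: handled_at_remove)
next
  case (step_A S s \<Sigma> \<sigma> P M)
  then have \<sigma>: "\<sigma> \<in> Sigma_init T s" "\<sigma> \<in> \<Sigma>" and s: "s \<in> even_dirs T" by auto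
  \<comment> \<open>An exhausted W without a hit means that there was nothing to find: the entry of
    a matching seedlet lies in \<open>W_init\<close>, so it would have been removed as a
    hit.\<close>
  have "M = handled T d S \<union> handled_at T d s \<Sigma> \<union> pairs_for T d s \<sigma>"
  proof (cases "pairs_for T d s \<sigma> = {}")
    case False
    then obtain \<omega> where \<omega>: "is_seedlet s \<omega>" "coefs_match T s \<sigma> (exchange_poly \<omega>)"
      by (auto simp: pairs_for_def)
    obtain b r Z where brZ: "\<omega> = (b, r, Z)" by (cases \<omega>)
    have "(b, r) \<in> W_init T s \<sigma>"
      using in_W_init[OF T s \<sigma>(1)] \<omega> brZ by blast
    moreover have "P = exchange_poly (b, r, Z)" using step_A \<omega> brZ by auto
    ultimately have "\<not> (\<forall>b r Z. (b, r) \<in> W_init T s \<sigma> - {} \<longrightarrow>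
        \<not> (is_seedlet s (b, r, Z) \<and> P = exchange_poly (b, r, Z)))"
      using \<omega>(1) brZ by blast
    then show ?thesis using step_A unfolding routine_inv.simps by argo
  qed (use step_A in auto)
  with step_A \<sigma> show ?case by (auto simp: handled_at_remove)
next
  case (step_B_found T' d' b r W s Z P S \<Sigma> \<sigma> M)
  then have T': "T' = T \<and> d' = d" using T type_rep_unique by blast
  have *: "is_seedlet s \<omega> \<Longrightarrow> coefs_match T s \<sigma> (exchange_poly \<omega>) \<longleftrightarrow> P = exchange_poly \<omega>" for \<omega>
    using step_B_found.prems unfolding routine_inv.simps by blast
  \<comment> \<open>The found seedlet alone gives all pairs for \<sigma>, so the first alternative
    of the invariant holds after any hit, and repeated hits leave M unchanged.\<close>
  have "pairs_for T d s \<sigma> = {(cs_map \<sigma> s (b, r, Z), d') | d'. d' \<in> free_tuples T d s \<sigma>}"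
    using step_B_found * by (intro pairs_for_exchange) auto
  with step_B_found T' show ?case by auto
next
  case (step_B_none b r W s P S \<Sigma> \<sigma> M)
  then have "r > 0" by (auto simp: W_init_def)
  note none = treated_no_seedlet[OF step_B_none(2) this]
  have "M = handled T d S \<union> handled_at T d s \<Sigma> \<union> pairs_for T d s \<sigma> \<or>
      M = handled T d S \<union> handled_at T d s \<Sigma> \<and>
        (\<forall>b r Z. (b, r) \<in> W_init T s \<sigma> - W \<longrightarrow> \<not> (is_seedlet s (b, r, Z) \<and> P = exchange_poly (b, r, Z)))"
    using step_B_none.prems unfolding routine_inv.simps by argo
  then have "M = handled T d S \<union> handled_at T d s \<Sigma> \<union> pairs_for T d s \<sigma> \<or>
      M = handled T d S \<union> handled_at T d s \<Sigma> \<and>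
        (\<forall>b' r' Z. (b', r') \<in> W_init T s \<sigma> - (W - treated (b, r)) \<longrightarrow>
          \<not> (is_seedlet s (b', r', Z) \<and> P = exchange_poly (b', r', Z)))"
    using none by (elim disjE) blast+
  moreover have "W - treated (b, r) \<subseteq> W_init T s \<sigma>" using step_B_none.prems by auto
  ultimately show ?case
    using step_B_none.prems unfolding routine_inv.simps by - (elim conjE, intro conjI)
qed

text \<open>The two rules of each loop body are complementary. Only \<open>At_a\<close> draws on the
  invariant: an admissible k0 is guaranteed for directions and permutations from the initial
  sets.\<close>

lemma routine_progress:
  assumes T: "type_rep F T d" and inv: "routine_inv T d c" and stuck: "\<nexists>c'. routine_step F c c'"
  shows "\<exists>M. c = Stop M"
proof (cases c)
  case Start
  then show ?thesis using stuck step_1[OF T] by blast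
next
  case (At_2 S M)
  then show ?thesis using stuck step_2[of F M] step_3[OF T, of _ S M] by (cases "S = {}") blast+
next
  case (At_a S s \<Sigma> M)
  show ?thesis
  proof (cases "\<Sigma> = {}")
    case True
    then show ?thesis using stuck step_a[of F S s M] At_a by blast
  next
    case False
    then obtain \<sigma> where \<sigma>: "\<sigma> \<in> \<Sigma>" by blast
    have "s \<in> even_dirs T" "\<sigma> \<in> Sigma_init T s" using inv At_a \<sigma> by auto
    then obtain h fs ft k0 where *: "mdeg s T = 2 * h" "expansion s T fs" "expansion (inv \<sigma> s) T ft"
      "k0_choice h fs ft k0"
      using k0_choice_exists[OF T] by blast
    have "\<exists>c'. routine_step F c c'"
    proof (cases "\<exists>P. P_passes h fs ft \<sigma> k0 P")
      case True
      then show ?thesis using step_b_pass[OF T \<sigma> *] At_a by blast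
    next
      case False
      then show ?thesis using step_b_fail[OF T \<sigma> *] At_a by blast
    qed
    with stuck show ?thesis by blast
  qed
next
  case (At_A S s \<Sigma> \<sigma> P W M)
  show ?thesis
  proof (cases "W = {}")
    case True
    then show ?thesis using stuck step_A[of F S s \<Sigma> \<sigma> P M] At_A by blast
  next
    case False
    then obtain b r where br: "(b, r) \<in> W" by auto
    have "\<exists>c'. routine_step F c c'"
    proof (cases "\<exists>Z. is_seedlet s (b, r, Z) \<and> P = exchange_poly (b, r, Z)")
      case True
      then obtain Z where Z: "is_seedlet s (b, r, Z)" "P = exchange_poly (b, r, Z)" by blast
      show ?thesis unfolding At_A using step_B_found[OF T br Z] by blast
    next
      case False
      show ?thesis unfolding At_A using step_B_none[OF br False] by blast
    qed
    with stuck show ?thesis by blast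
  qed
qed auto

text \<open>W can be infinite only through entries with b = 0. These vanish in a single step, so
  together they count as 1.\<close>

definition W_size :: "(('n \<Rightarrow> int) \<times> nat) set \<Rightarrow> nat" where
  "W_size W = card {(b, r). (b, r) \<in> W \<and> b \<noteq> (\<lambda>_. 0)} + (if \<exists>r. (\<lambda>_. 0, r) \<in> W then 1 else 0)"

lemma W_size_treated:
  assumes "finite {(b, r). (b, r) \<in> W \<and> b \<noteq> (\<lambda>_. 0)}" "(b, r) \<in> W"
  shows "W_size (W - treated (b, r)) < W_size W"
proof (cases "b = (\<lambda>_. 0)")
  case True
  then have "{(b', r'). (b', r') \<in> W - treated (b, r) \<and> b' \<noteq> (\<lambda>_. 0)} = {(b', r'). (b', r') \<in> W \<and> b' \<noteq> (\<lambda>_. 0)}"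
    "\<nexists>r'. (\<lambda>_. 0, r') \<in> W - treated (b, r)"
    by (auto simp: treated_def)
  moreover have "\<exists>r'. (\<lambda>_. 0, r') \<in> W" using True assms(2) by blast
  ultimately show ?thesis unfolding W_size_def by simp
next
  case False
  have "{(b', r'). (b', r') \<in> W - treated (b, r) \<and> b' \<noteq> (\<lambda>_. 0)} \<subset> {(b', r'). (b', r') \<in> W \<and> b' \<noteq> (\<lambda>_. 0)}"
    using False assms(2) by (auto simp: treated_def)
  from psubset_card_mono[OF assms(1) this]
  have "card {(b', r'). (b', r') \<in> W - treated (b, r) \<and> b' \<noteq> (\<lambda>_. 0)} < card {(b', r'). (b', r') \<in> W \<and> b' \<noteq> (\<lambda>_. 0)}" .
  moreover have "(\<exists>r'. (\<lambda>_. 0, r') \<in> W - treated (b, r)) \<longleftrightarrow> (\<exists>r'. (\<lambda>_. 0, r') \<in> W)"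
    using False by (auto simp: treated_def)
  ultimately show ?thesis unfolding W_size_def by simp
qed

text \<open>Compared lexicographically. The +1 in \<open>At_2\<close> pays for entering the loop
  over \<Sigma> with S unchanged, and for stopping at S = {}. The +1 after
  \<open>card \<Sigma>\<close> pays for the return to \<open>At_2\<close>, where the first entry
  stays equal. The third entry pays for entering the loop over W.\<close>

fun state_size :: "'n::{finite,linorder} state \<Rightarrow> nat \<times> nat \<times> nat \<times> nat" where
  "state_size Start = (card (UNIV :: 'n set) + 2, 0, 0, 0)"
| "state_size (At_2 S M) = (card S + 1, 0, 0, 0)"
| "state_size (At_a S s \<Sigma> M) = (card S, card \<Sigma> + 1, 1, 0)"
| "state_size (At_A S s \<Sigma> \<sigma> P W M) = (card S, card \<Sigma> + 1, 0, W_size W)"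
| "state_size (Stop M) = (0, 0, 0, 0)"

definition size_rel :: "((nat \<times> nat \<times> nat \<times> nat) \<times> (nat \<times> nat \<times> nat \<times> nat)) set" where
  "size_rel = less_than <*lex*> less_than <*lex*> less_than <*lex*> less_than"

lemma state_size_decreases:
  assumes T: "type_rep F T d"
  shows "routine_step F c c' \<Longrightarrow> routine_inv T d c \<Longrightarrow> (state_size c', state_size c) \<in> size_rel"
proof (induction rule: routine_step.induct)
  case (step_1 T' d')
  have "card (even_dirs T') \<le> card (UNIV :: 'a set)" by (rule card_mono) auto
  then show ?case by (simp add: size_rel_def)
next
  case (step_a S s M)
  then have "card S > 0" by (auto simp: card_gt_0_iff)
  with step_a show ?case by (auto simp: size_rel_def)
next
  case (step_b_fail T' d' \<sigma> \<Sigma> s h fs ft k0 S M)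
  then have "card \<Sigma> > 0" by (auto simp: card_gt_0_iff)
  with step_b_fail show ?case by (auto simp: size_rel_def)
next
  case (step_A S s \<Sigma> \<sigma> P M)
  then have "card \<Sigma> > 0" by (auto simp: card_gt_0_iff)
  with step_A show ?case by (auto simp: size_rel_def)
next
  case (step_B_found T' d' b r W s Z P S \<Sigma> \<sigma> M)
  have "finite {(b, r). (b, r) \<in> W \<and> b \<noteq> (\<lambda>_. 0)}"
    by (rule finite_subset[OF _ finite_W_init_nonzero[of s T \<sigma>]]) (use step_B_found in auto)
  with step_B_found show ?case by (auto simp: size_rel_def intro: W_size_treated)
next
  case (step_B_none b r W s P S \<Sigma> \<sigma> M)
  have "finite {(b, r). (b, r) \<in> W \<and> b \<noteq> (\<lambda>_. 0)}"
    by (rule finite_subset[OF _ finite_W_init_nonzero[of s T \<sigma>]]) (use step_B_none in auto)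
  with step_B_none show ?case by (auto simp: size_rel_def intro: W_size_treated)
qed (auto simp: size_rel_def)

lemma routine_terminates:
  assumes T: "type_rep F T d"
  shows "\<nexists>run. run 0 = Start \<and> (\<forall>k::nat. routine_step F (run k) (run (Suc k)))"
proof
  assume "\<exists>run. run 0 = Start \<and> (\<forall>k::nat. routine_step F (run k) (run (Suc k)))"
  then obtain run where run: "run 0 = Start" "\<And>k::nat. routine_step F (run k) (run (Suc k))" by blast
  have inv: "routine_inv T d (run k)" for k
    by (induction k) (use run routine_inv_step[OF T] in auto)
  have "(state_size (run (Suc k)), state_size (run k)) \<in> size_rel" for k
    using state_size_decreases[OF T run(2) inv] .
  moreover have "wf size_rel" by (auto simp: size_rel_def)
  ultimately show False
    using wf_no_infinite_down_chainE[of size_rel "\<lambda>k. state_size (run k)"] by blast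
qed

lemma routine_result:
  assumes T: "type_rep F T d" and "(routine_step F)\<^sup>*\<^sup>* Start c" "\<nexists>c'. routine_step F c c'"
  shows "c = Stop (nontrivial_cs_pairs F)"
proof -
  have inv: "routine_inv T d c"
    using assms(2) by (induction rule: rtranclp_induct) (auto intro: routine_inv_step[OF T])
  then obtain M where "c = Stop M"
    using routine_progress[OF T _ assms(3)] by blast
  with inv show ?thesis by (simp add: handled_def nontrivial_cs_pairs_eq[OF T])
qed

text \<open>Only a nonzero F has a type. Runs are finite for every resolution of the choices, and
  each maximal run ends in \<open>Stop\<close> with the same set.\<close>

theorem theorem1p3:
  fixes F :: "'n::{finite,linorder} laurent"
  assumes "F \<noteq> 0"
  shows "(\<nexists>run. run 0 = Start \<and> (\<forall>k::nat. routine_step F (run k) (run (Suc k)))) \<and>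
    (\<forall>c. (routine_step F)\<^sup>*\<^sup>* Start c \<and> (\<nexists>c'. routine_step F c c') \<longrightarrow>
      c = Stop (nontrivial_cs_pairs F)) \<and>
    cluster_symmetric_set F = {\<psi>. (\<psi>, \<lambda>_. 0) \<in> nontrivial_cs_pairs F}"
proof -
  obtain T d where T: "type_rep F T d"
    using type_rep_exists_general[OF assms] by blast
  show ?thesis
    using routine_terminates[OF T] routine_result[OF T] cluster_symmetric_set_eq[OF T] by blast
qed

end
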